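(* Let $0<\alpha<n$ and let $$X_\alpha:=\{f\in L^1_{\rm loc}(\mathbb{R}^n):\mathcal{M}_\alpha f\in L^\infty(\mathbb{R}^n)\}.$$ Let $\widetilde{X_\alpha}$ be the union of all rearrangement invariant spaces $Y$ on $\mathbb{R}^n$ with $Y\subset X_\alpha$. Then $\widetilde{X_\alpha}=L^{n/\alpha,\infty}(\mathbb{R}^n)$. Hence, $L^{n/\alpha,\infty}(\mathbb{R}^n)$ is the largest rearrangement invariant space $Y$ for which $\mathcal{M}_\alpha:Y\to L^\infty(\mathbb{R}^n)$ is bounded.
   Context: $\mathcal{M}_\alpha(f)(x)=\sup_{Q\ni x}|Q|^{\alpha/n}\frac1{|Q|}\int_Q|f|$, the supremum being over cubes $Q\subset\mathbb{R}^n$ with sides parallel to the coordinate axes containing $x$. The nonincreasing rearrangement of $f$ is $f^*(t)=\inf\{s>0:|\{x\in\mathbb{R}^n:|f(x)|>s\}|<t\}$, $t>0$, and $f^{**}(t)=\frac1t\int_0^tf^*(s)\,ds$. A rearrangement invariant (r.i.) space is a space $Y=\{f\text{ measurable on }\mathbb{R}^n:\|f\|<\infty\}$ with a norm $\|\cdot\|$ (a Banach function norm) satisfying: (i) $\|f\|\le\|g\|$ if $|f|\le|g|$; (ii) if $0\le f_k\le f_{k+1}\to f$ a.e., then $\|f_k\|\to\|f\|$; (iii) $\chi_E\in Y$ if $|E|<\infty$; (iv) for each measurable $E$ with $|E|<\infty$ there is $C_E$ with $\int_E|f|\le C_E\|f\|$; (v) $\|f\|=\|g\|$ if $f^*=g^*$.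 $L^{n/\alpha,\infty}(\mathbb{R}^n)$ is weak $L^{n/\alpha}$, i.e. the measurable $f$ with $\sup_{t>0}t^{\alpha/n}f^*(t)<\infty$; as an r.i. space it carries the equivalent norm $\sup_{t>0}t^{\alpha/n}f^{**}(t)$. *)

theory Defs
  imports "HOL-Analysis.Analysis" "HOL-Probability.Essential_Supremum"
begin

definition cubes :: "(real ^ 'n) set set" where
  "cubes = {cbox a b | a b. \<exists>l>0. \<forall>i. b $ i - a $ i = l}"

text \<open>Values in \<open>[0, \<infinity>]\<close>, so that no integrability of \<open>f\<close> has to be presupposed.\<close>

definition frac_maximal :: "real \<Rightarrow> (real ^ 'n \<Rightarrow> real) \<Rightarrow> real ^ 'n \<Rightarrow> ennreal" where
  "frac_maximal \<alpha> f x =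
     (SUP Q\<in>{Q \<in> cubes. x \<in> Q}.
        ennreal (measure lebesgue Q powr (\<alpha> / CARD('n)) * (1 / measure lebesgue Q)) *
        (\<integral>\<^sup>+y\<in>Q. ennreal \<bar>f y\<bar> \<partial>lebesgue))"

text \<open>The infimum of the empty set is \<open>\<infinity>\<close>. Only arguments \<open>t > 0\<close> are meaningful.\<close>

definition rearrangement :: "(real ^ 'n \<Rightarrow> real) \<Rightarrow> real \<Rightarrow> ennreal" where
  "rearrangement f t =
     Inf (ennreal ` {s. s > 0 \<and> emeasure lebesgue {x. \<bar>f x\<bar> > s} < ennreal t})"

definition max_rearrangement :: "(real ^ 'n \<Rightarrow> real) \<Rightarrow> real \<Rightarrow> ennreal" where
  "max_rearrangement f t = ennreal (1 / t) * (\<integral>\<^sup>+s\<in>{0<..t}. rearrangement f s \<partial>lborel)"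

text \<open>
  A rearrangement invariant space is given by its norm, extended by \<open>\<infinity>\<close> to all Lebesgue measurable
  functions; functions are identified almost everywhere. The values of the norm on
  non-measurable functions are irrelevant.
\<close>

locale ri_norm =
  fixes \<rho> :: "(real ^ 'n \<Rightarrow> real) \<Rightarrow> ennreal"
  assumes zero_iff:
      "f \<in> borel_measurable lebesgue \<Longrightarrow> \<rho> f = 0 \<longleftrightarrow> (AE x in lebesgue. f x = 0)"
    and scale:
      "f \<in> borel_measurable lebesgue \<Longrightarrow> \<rho> (\<lambda>x. c * f x) = ennreal \<bar>c\<bar> * \<rho> f"
    and triangle:
      "f \<in> borel_measurable lebesgue \<Longrightarrow> g \<in> borel_measurable lebesgue \<Longrightarrow>
       \<rho> (\<lambda>x. f x + g x) \<le> \<rho> f + \<rho> g"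
    and lattice:
      "f \<in> borel_measurable lebesgue \<Longrightarrow> g \<in> borel_measurable lebesgue \<Longrightarrow>
       (AE x in lebesgue. \<bar>f x\<bar> \<le> \<bar>g x\<bar>) \<Longrightarrow> \<rho> f \<le> \<rho> g"
    and fatou:
      "(\<And>k::nat. F k \<in> borel_measurable lebesgue) \<Longrightarrow> f \<in> borel_measurable lebesgue \<Longrightarrow>
       (AE x in lebesgue. (\<forall>k. 0 \<le> F k x \<and> F k x \<le> F (Suc k) x) \<and>
                          (\<lambda>k. F k x) \<longlonglongrightarrow> f x) \<Longrightarrow>
       (\<lambda>k. \<rho> (F k)) \<longlonglongrightarrow> \<rho> f"
    and indicator_finite:
      "E \<in> sets lebesgue \<Longrightarrow> emeasure lebesgue E < \<infinity> \<Longrightarrow> \<rho> (indicator E) < \<infinity>"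
    and local_integral_bound:
      "E \<in> sets lebesgue \<Longrightarrow> emeasure lebesgue E < \<infinity> \<Longrightarrow>
       \<exists>C::real. \<forall>f \<in> borel_measurable lebesgue.
         (\<integral>\<^sup>+x\<in>E. ennreal \<bar>f x\<bar> \<partial>lebesgue) \<le> ennreal C * \<rho> f"
    and rearrangement_invariant:
      "f \<in> borel_measurable lebesgue \<Longrightarrow> g \<in> borel_measurable lebesgue \<Longrightarrow>
       (\<forall>t>0. rearrangement f t = rearrangement g t) \<Longrightarrow> \<rho> f = \<rho> g"

definition ri_space :: "((real ^ 'n \<Rightarrow> real) \<Rightarrow> ennreal) \<Rightarrow> (real ^ 'n \<Rightarrow> real) set" where
  "ri_space \<rho> = {f \<in> borel_measurable lebesgue. \<rho> f < \<infinity>}"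

definition L1_loc :: "(real ^ 'n \<Rightarrow> real) set" where
  "L1_loc = {f \<in> borel_measurable lebesgue. \<forall>K. compact K \<longrightarrow> set_integrable lebesgue K f}"

text \<open>
  For a \<open>[0, \<infinity>]\<close>-valued \<open>g\<close>, membership of \<open>g\<close> in \<open>L\<^sup>\<infinity>\<close> is \<open>esssup lebesgue g < \<infinity>\<close>; this
  includes measurability, since \<^const>\<open>esssup\<close> of a non-measurable function is \<open>\<infinity>\<close>.
\<close>

definition X_space :: "real \<Rightarrow> (real ^ 'n \<Rightarrow> real) set" where
  "X_space \<alpha> = {f \<in> L1_loc. esssup lebesgue (frac_maximal \<alpha> f) < \<infinity>}"

definition X_tilde :: "real \<Rightarrow> (real ^ 'n \<Rightarrow> real) set" where
  "X_tilde \<alpha> = \<Union> {ri_space \<rho> | \<rho>. ri_norm \<rho> \<and> ri_space \<rho> \<subseteq> X_space \<alpha>}"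

definition weak_Lp :: "real \<Rightarrow> (real ^ 'n \<Rightarrow> real) set" where
  "weak_Lp p = {f \<in> borel_measurable lebesgue.
     (SUP t\<in>{0<..}. ennreal (t powr (1 / p)) * rearrangement f t) < \<infinity>}"

definition weak_Lp_norm :: "real \<Rightarrow> (real ^ 'n \<Rightarrow> real) \<Rightarrow> ennreal" where
  "weak_Lp_norm p f = (SUP t\<in>{0<..}. ennreal (t powr (1 / p)) * max_rearrangement f t)"

definition frac_maximal_bounded :: "real \<Rightarrow> ((real ^ 'n \<Rightarrow> real) \<Rightarrow> ennreal) \<Rightarrow> bool" where
  "frac_maximal_bounded \<alpha> \<rho> \<longleftrightarrow>
     (\<exists>C::real. \<forall>f \<in> ri_space \<rho>. esssup lebesgue (frac_maximal \<alpha> f) \<le> ennreal C * \<rho> f)"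

end

theory Submission
  imports Defs
begin

text \<open>
  By the layer cake formula \<open>t f**(t) = \<integral>\<^sub>0\<^sup>\<infinity> min(t, \<mu>\<^sub>f(u)) du\<close>, where \<open>\<mu>\<^sub>f\<close> is the distribution
  function. This makes \<open>\<integral>\<^sub>E \<bar>f\<bar> \<le> \<bar>E\<bar> f**(\<bar>E\<bar>)\<close> and the Fatou property evident, and it
  bounds the fractional maximal function pointwise by the norm \<open>sup\<^sub>t t\<^bsup>\<alpha>/n\<^esup> f**(t)\<close>.

  Conversely, let \<open>f\<close> lie in a rearrangement invariant space contained in \<open>X\<^sub>\<alpha>\<close>. The space also
  contains the equimeasurable function \<open>g(x) = f*(v(x))\<close>, where \<open>v(x)\<close> is the volume of the smallest
  cube centred at the origin containing \<open>x\<close>. Testing the maximal function of \<open>g\<close> on the centred cube of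
  volume \<open>t\<close>, on which \<open>g \<ge> f*(t)\<close>, yields \<open>t\<^bsup>\<alpha>/n\<^esup> f*(t) \<le> \<parallel>M\<^sub>\<alpha> g\<parallel>\<^sub>\<infinity>\<close>. If \<open>f*\<close> takes
  the value \<open>\<infinity>\<close>, then \<open>\<mu>\<^sub>f = \<infinity>\<close> identically and \<open>g = 1 + v\<close>, whose maximal function is
  infinite everywhere, is equimeasurable with \<open>f\<close>.
\<close>

section \<open>The layer cake formula\<close>

text \<open>A countable Borel cover by sets of finite measure also serves the completion, which
  agrees with \<open>lborel\<close> on Borel sets. Fubini in \<open>layer_cake\<close> needs
  it.\<close>

lemma sigma_finite_lebesgue: "sigma_finite_measure (lebesgue :: 'a::euclidean_space measure)"
proof
  obtain A :: "'a set set" where "countable A" "A \<subseteq> sets lborel" "\<Union>A = space lborel"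
    "\<forall>a\<in>A. emeasure lborel a \<noteq> \<infinity>"
    using lborel.sigma_finite_countable by blast
  then show "\<exists>A. countable A \<and> A \<subseteq> sets (lebesgue :: 'a measure) \<and> \<Union>A = space lebesgue \<and>
      (\<forall>a\<in>A. emeasure lebesgue a \<noteq> \<infinity>)"
    by (intro exI[of _ A]) (auto simp: emeasure_completion sets_completionI_sets)
qed

lemma emeasure_lborel_greaterThan [simp]: "emeasure lborel {k::real<..} = top"
proof (rule ccontr)
  assume "emeasure lborel {k<..} \<noteq> top"
  then obtain r where r: "emeasure lborel {k<..} = ennreal r" "0 \<le> r"
    by (cases "emeasure lborel {k<..}") auto
  have "emeasure lborel {k<..<k + (r + 1)} \<le> emeasure lborel {k<..}"
    by (intro emeasure_mono) auto
  then show False using r by simp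
qed

text \<open>The pointwise form of the layer cake formula: the set is the open interval from
  \<open>k\<close> to \<open>h\<close>, and it is empty exactly where the truncated difference
  vanishes.\<close>

lemma ennreal_minus_eq_emeasure:
  fixes h :: ennreal
  assumes "0 \<le> k"
  shows "h - ennreal k = emeasure lborel {u. k < u \<and> ennreal u < h}"
proof (cases h)
  case (real r)
  show ?thesis
  proof (cases "k \<le> r")
    case True
    have "{u. k < u \<and> ennreal u < h} = {k<..<r}"
      using assms real by (auto simp: ennreal_less_iff)
    then show ?thesis using True assms real by (simp add: ennreal_minus)
  next
    case False
    have "{u. k < u \<and> ennreal u < h} = {}"
      using assms real False by (auto simp: ennreal_less_iff)
    then have "emeasure lborel {u. k < u \<and> ennreal u < h} = 0" by (metis emeasure_empty)
    then show ?thesis using False assms real by (simp add: ennreal_minus ennreal_neg)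
  qed
next
  case top
  have "{u. k < u \<and> ennreal u < h} = {k<..}" using top by auto
  then show ?thesis using top by simp
qed

lemma layer_cake:
  fixes h :: "'a \<Rightarrow> ennreal"
  assumes M: "sigma_finite_measure M" and h[measurable]: "h \<in> borel_measurable M" and k: "0 \<le> k"
  shows "(\<integral>\<^sup>+x. h x - ennreal k \<partial>M) =
    (\<integral>\<^sup>+u\<in>{k<..}. emeasure M {x \<in> space M. ennreal u < h x} \<partial>lborel)"
proof -
  interpret M: sigma_finite_measure M by fact
  interpret pair_sigma_finite M lborel by unfold_locales
  have "(\<integral>\<^sup>+x. h x - ennreal k \<partial>M) =
      (\<integral>\<^sup>+x. \<integral>\<^sup>+u. indicator {u. k < u \<and> ennreal u < h x} u \<partial>lborel \<partial>M)"
    by (intro nn_integral_cong, subst nn_integral_indicator)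
       (auto simp: ennreal_minus_eq_emeasure[OF k])
  \<comment> \<open>The region is written as one subset of the product space, so that its joint
    measurability is available for exchanging the integrals.\<close>
  also have "\<dots> = (\<integral>\<^sup>+x. \<integral>\<^sup>+u. indicator {z \<in> space (M \<Otimes>\<^sub>M lborel). k < snd z \<and> ennreal (snd z) < h (fst z)} (x, u) \<partial>lborel \<partial>M)"
    by (intro nn_integral_cong) (auto split: split_indicator simp: space_pair_measure)
  also have "\<dots> = (\<integral>\<^sup>+u. \<integral>\<^sup>+x. indicator {z \<in> space (M \<Otimes>\<^sub>M lborel). k < snd z \<and> ennreal (snd z) < h (fst z)} (x, u) \<partial>M \<partial>lborel)"
    by (rule Fubini'[symmetric]) measurable
  also have "\<dots> = (\<integral>\<^sup>+u. \<integral>\<^sup>+x. indicator {x \<in> space M. ennreal u < h x} x * indicator {k<..} u \<partial>M \<partial>lborel)"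
    by (intro nn_integral_cong) (auto split: split_indicator simp: space_pair_measure)
  also have "\<dots> = (\<integral>\<^sup>+u\<in>{k<..}. emeasure M {x \<in> space M. ennreal u < h x} \<partial>lborel)"
    by (intro nn_integral_cong) (simp add: nn_integral_multc)
  finally show ?thesis .
qed

section \<open>Distribution function and rearrangement\<close>

definition dist_fun :: "(real ^ 'n \<Rightarrow> real) \<Rightarrow> real \<Rightarrow> ennreal" where
  "dist_fun f u = emeasure lebesgue {x. u < \<bar>f x\<bar>}"

lemma rearrangement_eq_dist_fun:
  "rearrangement f t = Inf (ennreal ` {s. 0 < s \<and> dist_fun f s < ennreal t})"
  by (simp add: rearrangement_def dist_fun_def)

lemma superlevel_measurable [measurable]:
  "f \<in> borel_measurable lebesgue \<Longrightarrow> {x. u < \<bar>f x :: real\<bar>} \<in> sets lebesgue"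
  using measurable_sets[of "\<lambda>x. \<bar>f x\<bar>" lebesgue borel "{u<..}"] by (simp add: vimage_def)

lemma dist_fun_antimono:
  assumes "f \<in> borel_measurable lebesgue" "u \<le> v"
  shows "dist_fun f v \<le> dist_fun f u"
  unfolding dist_fun_def using assms by (intro emeasure_mono) auto

lemma borel_measurable_antimono:
  fixes f :: "real \<Rightarrow> ennreal"
  assumes "antimono f"
  shows "f \<in> borel_measurable borel"
proof (rule borel_measurableI_greater)
  fix y
  have "is_interval {x. y < f x}"
    unfolding is_interval_1 using antimonoD[OF assms] by (auto intro: less_le_trans)
  then have "{x. y < f x} \<in> sets borel"
    by (rule real_interval_borel_measurable)
  then show "{x \<in> space borel. y < f x} \<in> sets borel" by simp
qed

lemma dist_fun_measurable:
  assumes "f \<in> borel_measurable lebesgue"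
  shows "dist_fun f \<in> borel_measurable borel"
  using dist_fun_antimono[OF assms] by (intro borel_measurable_antimono) (auto simp: antimono_def)

lemma dist_fun_mono:
  assumes "f \<in> borel_measurable lebesgue" "g \<in> borel_measurable lebesgue"
    "AE x in lebesgue. \<bar>f x\<bar> \<le> \<bar>g x\<bar>"
  shows "dist_fun f u \<le> dist_fun g u"
  unfolding dist_fun_def using assms by (intro emeasure_mono_AE) auto

text \<open>The indicators of the superlevel sets increase almost everywhere to that of
  \<open>f\<close>, so monotone convergence applies. Arguing with indicators rather than with unions
  of sets tolerates the exceptional null sets.\<close>

lemma dist_fun_SUP:
  assumes F: "\<And>k::nat. F k \<in> borel_measurable lebesgue" and f: "f \<in> borel_measurable lebesgue"
    and mono: "AE x in lebesgue. \<forall>k. \<bar>F k x\<bar> \<le> \<bar>F (Suc k) x\<bar>"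
    and sup: "AE x in lebesgue. u < \<bar>f x\<bar> \<longleftrightarrow> (\<exists>k. u < \<bar>F k x\<bar>)"
  shows "dist_fun f u = (SUP k. dist_fun (F k) u)"
proof -
  have m: "AE x in lebesgue. (indicator {x. u < \<bar>F k x\<bar>} x :: ennreal) \<le> indicator {x. u < \<bar>F (Suc k) x\<bar>} x" for k
    using mono by eventually_elim (auto split: split_indicator dest: spec[of _ k])
  have "dist_fun f u = (\<integral>\<^sup>+x. indicator {x. u < \<bar>f x\<bar>} x \<partial>lebesgue)"
    using f by (simp add: dist_fun_def)
  also have "\<dots> = (\<integral>\<^sup>+x. (SUP k. indicator {x. u < \<bar>F k x\<bar>} x) \<partial>lebesgue)"
  proof (intro nn_integral_cong_AE)
    show "AE x in lebesgue. (indicator {x. u < \<bar>f x\<bar>} x :: ennreal) = (SUP k. indicator {x. u < \<bar>F k x\<bar>} x)"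
      using sup
    proof eventually_elim
      case (elim x)
      show ?case
      proof (cases "u < \<bar>f x\<bar>")
        case True
        then obtain k where "u < \<bar>F k x\<bar>" using elim by blast
        then have "1 \<le> (SUP k. indicator {x. u < \<bar>F k x\<bar>} x :: ennreal)"
          by (intro SUP_upper2[of k]) auto
        moreover have "(SUP k. indicator {x. u < \<bar>F k x\<bar>} x :: ennreal) \<le> 1"
          by (intro SUP_least) (auto split: split_indicator)
        ultimately show ?thesis using True by simp
      next
        case False
        then show ?thesis using elim by simp
      qed
    qed
  qed
  also have "\<dots> = (SUP k. \<integral>\<^sup>+x. indicator {x. u < \<bar>F k x\<bar>} x \<partial>lebesgue)"
    using F by (intro nn_integral_monotone_convergence_SUP_AE m) auto
  also have "\<dots> = (SUP k. dist_fun (F k) u)"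
    using F by (simp add: dist_fun_def)
  finally show ?thesis .
qed

lemma rearrangement_le_ennreal:
  "\<lbrakk>0 < u; dist_fun f u < ennreal s\<rbrakk> \<Longrightarrow> rearrangement f s \<le> ennreal u"
  unfolding rearrangement_eq_dist_fun by (rule Inf_lower) auto

text \<open>One half of the statement that f* is a generalized inverse of mu_f;
  \<open>less_rearrangement_of_less_dist_fun\<close> is the other. Between them only the boundary
  value s = mu_f(u) stays undecided.\<close>

lemma dist_fun_ge_of_less_rearrangement:
  "\<lbrakk>0 < u; ennreal u < rearrangement f s\<rbrakk> \<Longrightarrow> ennreal s \<le> dist_fun f u"
  using rearrangement_le_ennreal[of u f s] by (meson leD leI)

text \<open>The strict inequality rests on the right-continuity of the distribution function.\<close>

lemma less_rearrangement_of_less_dist_fun: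
  assumes f: "f \<in> borel_measurable lebesgue" and "0 \<le> u" and less: "ennreal s < dist_fun f u"
  shows "ennreal u < rearrangement f s"
proof -
  have "dist_fun f u = (SUP k. emeasure lebesgue {x. u + inverse (real (Suc k)) < \<bar>f x\<bar>})"
  proof -
    have "(SUP k. emeasure lebesgue {x. u + inverse (real (Suc k)) < \<bar>f x\<bar>}) =
        emeasure lebesgue (\<Union>k. {x. u + inverse (real (Suc k)) < \<bar>f x\<bar>})"
    proof (rule SUP_emeasure_incseq)
      show "range (\<lambda>k. {x. u + inverse (real (Suc k)) < \<bar>f x\<bar>}) \<subseteq> sets lebesgue"
        using f by auto
      show "incseq (\<lambda>k. {x. u + inverse (real (Suc k)) < \<bar>f x\<bar>})"
        unfolding incseq_def
      proof (intro allI impI subsetI CollectI)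
        fix m n :: nat and x assume "m \<le> n" "x \<in> {x. u + inverse (real (Suc m)) < \<bar>f x\<bar>}"
        then have "u + inverse (real (Suc m)) < \<bar>f x\<bar>" by blast
        moreover have "inverse (real (Suc n)) \<le> inverse (real (Suc m))"
          using \<open>m \<le> n\<close> by (intro le_imp_inverse_le) auto
        ultimately show "u + inverse (real (Suc n)) < \<bar>f x\<bar>"
          by linarith
      qed
    qed
    also have "(\<Union>k. {x. u + inverse (real (Suc k)) < \<bar>f x\<bar>}) = {x. u < \<bar>f x\<bar>}"
    proof (intro equalityI subsetI)
      fix x assume "x \<in> {x. u < \<bar>f x\<bar>}"
      then obtain k where "inverse (real (Suc k)) < \<bar>f x\<bar> - u"
        using reals_Archimedean[of "\<bar>f x\<bar> - u"] by auto
      then show "x \<in> (\<Union>k. {x. u + inverse (real (Suc k)) < \<bar>f x\<bar>})" by (auto intro!: exI[of _ k])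
    next
      fix x assume "x \<in> (\<Union>k. {x. u + inverse (real (Suc k)) < \<bar>f x\<bar>})"
      then obtain k where "u + inverse (real (Suc k)) < \<bar>f x\<bar>" by auto
      moreover have "0 < inverse (real (Suc k))" by simp
      ultimately show "x \<in> {x. u < \<bar>f x\<bar>}" by (auto simp del: inverse_positive_iff_positive)
    qed
    finally show ?thesis by (simp add: dist_fun_def)
  qed
  \<comment> \<open>The superlevel set at \<open>u\<close> is the increasing union of those at u +
    1/(k+1), so the strict inequality survives at some level strictly above \<open>u\<close>. That
    level bounds all members of the infimum from below.\<close>
  then obtain k where k: "ennreal s < dist_fun f (u + inverse (real (Suc k)))"
    using less by (auto simp: less_SUP_iff dist_fun_def)
  have "ennreal u < ennreal (u + inverse (real (Suc k)))"
    using assms by (subst ennreal_less_iff) auto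
  also have "\<dots> \<le> rearrangement f s"
    unfolding rearrangement_eq_dist_fun
  proof (rule Inf_greatest)
    fix y assume "y \<in> ennreal ` {\<sigma>. 0 < \<sigma> \<and> dist_fun f \<sigma> < ennreal s}"
    then obtain \<sigma> where \<sigma>: "y = ennreal \<sigma>" "dist_fun f \<sigma> < ennreal s" by auto
    have "u + inverse (real (Suc k)) \<le> \<sigma>"
    proof (rule ccontr)
      assume "\<not> ?thesis"
      then have "dist_fun f (u + inverse (real (Suc k))) \<le> dist_fun f \<sigma>"
        by (intro dist_fun_antimono f) simp
      with \<sigma> k show False by order
    qed
    then show "ennreal (u + inverse (real (Suc k))) \<le> y" using \<sigma> by (simp add: ennreal_leI)
  qed
  finally show ?thesis .
qed

lemma rearrangement_antimono: "s \<le> t \<Longrightarrow> rearrangement f t \<le> rearrangement f s"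
  unfolding rearrangement_def
  by (intro Inf_superset_mono) (auto intro: less_le_trans ennreal_leI)

lemma rearrangement_mono:
  assumes "\<And>u. 0 < u \<Longrightarrow> dist_fun f u \<le> dist_fun g u"
  shows "rearrangement f t \<le> rearrangement g t"
  unfolding rearrangement_eq_dist_fun using assms
  by (intro Inf_superset_mono) (auto intro: le_less_trans)

lemma rearrangement_cong:
  assumes "\<And>u. 0 < u \<Longrightarrow> dist_fun f u = dist_fun g u"
  shows "rearrangement f t = rearrangement g t"
  using assms by (intro antisym rearrangement_mono) auto

lemma rearrangement_measurable [measurable]: "rearrangement f \<in> borel_measurable borel"
  by (intro borel_measurable_antimono) (auto simp: antimono_def rearrangement_antimono)

text \<open>Equimeasurability of f* and f, cut off at \<open>t\<close>. With m the minimum on the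
  right, the set lies in the interval \<open>{0<..m}\<close> and contains \<open>{0<..s}\<close> for
  every s < m.\<close>

lemma emeasure_rearrangement_superlevel:
  assumes f: "f \<in> borel_measurable lebesgue" and "0 < u" "0 < t"
  shows "emeasure lborel {s \<in> {0<..t}. ennreal u < rearrangement f s} = min (ennreal t) (dist_fun f u)"
    (is "emeasure _ ?S = ?m")
proof (rule antisym)
  obtain m where m: "?m = ennreal m" "0 \<le> m"
    by (metis ennreal_cases ennreal_less_top min_less_iff_disj order_less_irrefl)
  have "?S \<subseteq> {0<..m}"
  proof
    fix s assume s: "s \<in> ?S"
    then have "ennreal s \<le> ?m"
      using dist_fun_ge_of_less_rearrangement[OF \<open>0 < u\<close>, of f s] by (auto intro: ennreal_leI)
    then show "s \<in> {0<..m}" using s m by simp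
  qed
  then have "emeasure lborel ?S \<le> emeasure lborel {0<..m}"
    by (intro emeasure_mono) auto
  then show "emeasure lborel ?S \<le> ?m" using m by simp
  show "?m \<le> emeasure lborel ?S"
  \<comment> \<open>Whether the endpoint belongs to the set is undecided, so it is only approached
    from below.\<close>
  proof (rule dense_le)
    fix y assume y: "y < ?m"
    then obtain s where s: "y = ennreal s" "0 \<le> s"
      by (metis ennreal_cases less_top_ennreal m(1) order_less_trans top.not_eq_extremum ennreal_less_top)
    have *: "{0<..s} \<subseteq> ?S"
    proof
      fix r assume r: "r \<in> {0<..s}"
      then have "ennreal r \<le> ennreal s" by (auto intro: ennreal_leI)
      then have "ennreal r < dist_fun f u" "ennreal r < ennreal t" 
        using y s by (auto simp del: ennreal_le_iff intro: le_less_trans)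
      then show "r \<in> ?S"
        using r \<open>0 < u\<close> \<open>0 < t\<close> less_rearrangement_of_less_dist_fun[OF f, of u r] by (auto simp: ennreal_less_iff)
    qed
    have "y = emeasure lborel {0<..s}" using s by simp
    also have "\<dots> \<le> emeasure lborel ?S"
    proof (rule emeasure_mono[OF *])
      show "?S \<in> sets lborel" by measurable
    qed
    finally show "y \<le> emeasure lborel ?S" .
  qed
qed

lemma nn_integral_rearrangement:
  assumes f: "f \<in> borel_measurable lebesgue" and t: "0 < t"
  shows "(\<integral>\<^sup>+s\<in>{0<..t}. rearrangement f s \<partial>lborel) =
    (\<integral>\<^sup>+u\<in>{0<..}. min (ennreal t) (dist_fun f u) \<partial>lborel)"
proof -
  let ?h = "\<lambda>s. rearrangement f s * indicator {0<..t} s"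
  have "(\<integral>\<^sup>+s. ?h s \<partial>lborel) = (\<integral>\<^sup>+s. ?h s - ennreal 0 \<partial>lborel)" by simp
  also have "\<dots> = (\<integral>\<^sup>+u\<in>{0<..}. emeasure lborel {s \<in> space lborel. ennreal u < ?h s} \<partial>lborel)"
    by (rule layer_cake) (auto simp: lborel.sigma_finite_measure_axioms)
  also have "\<dots> = (\<integral>\<^sup>+u\<in>{0<..}. min (ennreal t) (dist_fun f u) \<partial>lborel)"
  proof (intro nn_integral_cong)
    fix u :: real
    show "emeasure lborel {s \<in> space lborel. ennreal u < ?h s} * indicator {0<..} u =
        min (ennreal t) (dist_fun f u) * indicator {0<..} u"
    proof (cases "0 < u")
      case True
      have "{s \<in> space lborel. ennreal u < ?h s} = {s \<in> {0<..t}. ennreal u < rearrangement f s}"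
        by (auto split: split_indicator_asm)
      then show ?thesis using emeasure_rearrangement_superlevel[OF f True t] by simp
    qed simp
  qed
  finally show ?thesis .
qed

lemma max_rearrangement_eq:
  assumes "f \<in> borel_measurable lebesgue" "0 < t"
  shows "max_rearrangement f t =
    ennreal (1 / t) * (\<integral>\<^sup>+u\<in>{0<..}. min (ennreal t) (dist_fun f u) \<partial>lborel)"
  by (simp add: max_rearrangement_def nn_integral_rearrangement[OF assms])

section \<open>The maximal rearrangement\<close>

lemma rearrangement_le_max_rearrangement:
  assumes "0 < t"
  shows "rearrangement f t \<le> max_rearrangement f t"
proof -
  have "rearrangement f t = ennreal (1 / t) * (rearrangement f t * ennreal t)"
    using assms by (simp add: ennreal_mult[symmetric] mult.left_commute)
  also have "rearrangement f t * ennreal t = (\<integral>\<^sup>+s\<in>{0<..t}. rearrangement f t \<partial>lborel)"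
    using assms by (simp add: nn_integral_cmult_indicator)
  also have "\<dots> \<le> (\<integral>\<^sup>+s\<in>{0<..t}. rearrangement f s \<partial>lborel)"
    by (intro nn_integral_mono) (auto split: split_indicator intro: rearrangement_antimono)
  finally show ?thesis
    by (simp add: max_rearrangement_def mult_left_mono)
qed

text \<open>Since \<open>ennreal\<close> sends negative numbers to 0, the integrand is the positive
  part of |f| - k, and the layer cake formula applies with base level \<open>k\<close>.\<close>

lemma nn_integral_excess:
  assumes f[measurable]: "f \<in> borel_measurable lebesgue" and "0 \<le> k"
  shows "(\<integral>\<^sup>+x. ennreal (\<bar>f x\<bar> - k) \<partial>lebesgue) = (\<integral>\<^sup>+u\<in>{k<..}. dist_fun f u \<partial>lborel)"
proof -
  have "(\<integral>\<^sup>+x. ennreal (\<bar>f x\<bar> - k) \<partial>lebesgue) = (\<integral>\<^sup>+x. ennreal \<bar>f x\<bar> - ennreal k \<partial>lebesgue)"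
    using \<open>0 \<le> k\<close> by (simp add: ennreal_minus)
  also have "\<dots> = (\<integral>\<^sup>+u\<in>{k<..}. emeasure lebesgue {x \<in> space lebesgue. ennreal u < ennreal \<bar>f x\<bar>} \<partial>lborel)"
    using \<open>0 \<le> k\<close> by (intro layer_cake sigma_finite_lebesgue) auto
  also have "\<dots> = (\<integral>\<^sup>+u\<in>{k<..}. dist_fun f u \<partial>lborel)"
    using \<open>0 \<le> k\<close>
    by (intro nn_integral_cong) (auto split: split_indicator simp: dist_fun_def ennreal_less_iff)
  finally show ?thesis .
qed

text \<open>
  The next two lemmas express \<open>t f**(t)\<close> as the \<open>K\<close>-functional of \<open>(L\<^sup>1, L\<^sup>\<infinity>)\<close>, i.e. as the
  minimum over \<open>k\<close> of \<open>\<parallel>(\<bar>f\<bar> - k)\<^sub>+\<parallel>\<^sub>1 + t k\<close>. Subadditivity of \<open>f \<mapsto> f**\<close> is immediate from this.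
\<close>

lemma nn_integral_min_dist_fun_le:
  assumes f: "f \<in> borel_measurable lebesgue" and "0 \<le> k" "0 \<le> t"
  shows "(\<integral>\<^sup>+u\<in>{0<..}. min (ennreal t) (dist_fun f u) \<partial>lborel) \<le>
    (\<integral>\<^sup>+x. ennreal (\<bar>f x\<bar> - k) \<partial>lebesgue) + ennreal (t * k)"
proof -
  note [measurable] = dist_fun_measurable[OF f]
  have "(\<integral>\<^sup>+u\<in>{0<..}. min (ennreal t) (dist_fun f u) \<partial>lborel) \<le>
      (\<integral>\<^sup>+u. dist_fun f u * indicator {k<..} u + ennreal t * indicator {0<..k} u \<partial>lborel)"
    by (intro nn_integral_mono) (auto split: split_indicator)
  also have "\<dots> = (\<integral>\<^sup>+u\<in>{k<..}. dist_fun f u \<partial>lborel) + ennreal (t * k)"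
    using assms(2,3)
    by (subst nn_integral_add) (auto simp: nn_integral_cmult_indicator ennreal_mult)
  finally show ?thesis by (simp add: nn_integral_excess[OF f \<open>0 \<le> k\<close>])
qed

lemma nn_integral_min_dist_fun_eq:
  assumes f: "f \<in> borel_measurable lebesgue" and "0 < t" and k: "rearrangement f t = ennreal k" "0 \<le> k"
  shows "(\<integral>\<^sup>+u\<in>{0<..}. min (ennreal t) (dist_fun f u) \<partial>lborel) =
    (\<integral>\<^sup>+x. ennreal (\<bar>f x\<bar> - k) \<partial>lebesgue) + ennreal (t * k)"
proof -
  note [measurable] = dist_fun_measurable[OF f]
  \<comment> \<open>The level k = f*(t) is where mu_f crosses the value \<open>t\<close>: below it
    the minimum is \<open>t\<close>, above it the minimum is mu_f.\<close>
  have small: "ennreal t \<le> dist_fun f u" if "0 < u" "u < k" for u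
    using that k by (intro dist_fun_ge_of_less_rearrangement) (auto simp: ennreal_less_iff)
  have large: "dist_fun f u \<le> ennreal t" if "k < u" for u
  proof (rule ccontr)
    assume "\<not> dist_fun f u \<le> ennreal t"
    then have "ennreal u < ennreal k"
      using less_rearrangement_of_less_dist_fun[OF f, of u t] that k by simp
    then show False using that k by (simp add: ennreal_less_iff)
  qed
  have "(\<integral>\<^sup>+u\<in>{0<..}. min (ennreal t) (dist_fun f u) \<partial>lborel) =
      (\<integral>\<^sup>+u. dist_fun f u * indicator {k<..} u + ennreal t * indicator {0<..k} u \<partial>lborel)"
  proof (rule nn_integral_cong_AE)
    show "AE u in lborel. min (ennreal t) (dist_fun f u) * indicator {0<..} u =
        dist_fun f u * indicator {k<..} u + ennreal t * indicator {0<..k} u"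
      \<comment> \<open>At the level \<open>k\<close> itself mu_f may already have jumped below
        \<open>t\<close>; this single point is discarded.\<close>
      using AE_lborel_singleton[of k]
    proof eventually_elim
      case (elim u)
      then consider "u \<le> 0" | "0 < u" "u < k" | "k < u" by linarith
      then show ?case
      proof cases
        case 2
        then show ?thesis using small[of u] by (simp add: min_absorb1)
      next
        case 3
        then show ?thesis using large[of u] k by (simp add: min_absorb2)
      qed (use k in auto)
    qed
  qed
  also have "\<dots> = (\<integral>\<^sup>+u\<in>{k<..}. dist_fun f u \<partial>lborel) + ennreal (t * k)"
    using k \<open>0 < t\<close>
    by (subst nn_integral_add) (auto simp: nn_integral_cmult_indicator ennreal_mult)
  finally show ?thesis by (simp add: nn_integral_excess[OF f \<open>0 \<le> k\<close>])
qed

text \<open>The levels k = f*(t) and l = g*(t) are optimal for \<open>f\<close> and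
  \<open>g\<close>, whereas for the sum any level gives an upper bound, in particular k + l.\<close>

lemma max_rearrangement_add_le:
  assumes f[measurable]: "f \<in> borel_measurable lebesgue" and g[measurable]: "g \<in> borel_measurable lebesgue"
    and t: "0 < t"
  shows "max_rearrangement (\<lambda>x. f x + g x) t \<le> max_rearrangement f t + max_rearrangement g t"
\<comment> \<open>An infinite rearrangement provides no real level, but then the right-hand side is
  infinite because f* \<le> f**.\<close>
proof (cases "rearrangement f t = top \<or> rearrangement g t = top")
  case True
  then show ?thesis
    using rearrangement_le_max_rearrangement[OF t, of f] rearrangement_le_max_rearrangement[OF t, of g]
    by (auto simp: top_unique)
next
  case False
  then obtain k l where k: "rearrangement f t = ennreal k" "0 \<le> k"
    and l: "rearrangement g t = ennreal l" "0 \<le> l"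
    by (metis ennreal_cases)
  have "(\<integral>\<^sup>+u\<in>{0<..}. min (ennreal t) (dist_fun (\<lambda>x. f x + g x) u) \<partial>lborel)
      \<le> (\<integral>\<^sup>+x. ennreal (\<bar>f x + g x\<bar> - (k + l)) \<partial>lebesgue) + ennreal (t * (k + l))"
    using k l t by (intro nn_integral_min_dist_fun_le) auto
  also have "\<dots> \<le> (\<integral>\<^sup>+x. ennreal (\<bar>f x\<bar> - k) + ennreal (\<bar>g x\<bar> - l) \<partial>lebesgue) + ennreal (t * (k + l))"
  proof (intro add_right_mono nn_integral_mono)
    fix x
    \<comment> \<open>The positive parts are made explicit because \<open>ennreal\<close> is
      additive only on nonnegative reals.\<close>
    have "ennreal (\<bar>f x + g x\<bar> - (k + l)) \<le> ennreal (max 0 (\<bar>f x\<bar> - k) + max 0 (\<bar>g x\<bar> - l))"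
      by (intro ennreal_leI) linarith
    also have "\<dots> = ennreal (max 0 (\<bar>f x\<bar> - k)) + ennreal (max 0 (\<bar>g x\<bar> - l))"
      by (simp add: ennreal_plus)
    also have "\<dots> = ennreal (\<bar>f x\<bar> - k) + ennreal (\<bar>g x\<bar> - l)"
      by (simp add: max_def ennreal_neg)
    finally show "ennreal (\<bar>f x + g x\<bar> - (k + l)) \<le> ennreal (\<bar>f x\<bar> - k) + ennreal (\<bar>g x\<bar> - l)" .
  qed
  also have "\<dots> = (\<integral>\<^sup>+u\<in>{0<..}. min (ennreal t) (dist_fun f u) \<partial>lborel) +
      (\<integral>\<^sup>+u\<in>{0<..}. min (ennreal t) (dist_fun g u) \<partial>lborel)"
  proof -
    have "(\<integral>\<^sup>+x. ennreal (\<bar>f x\<bar> - k) + ennreal (\<bar>g x\<bar> - l) \<partial>lebesgue) =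
        (\<integral>\<^sup>+x. ennreal (\<bar>f x\<bar> - k) \<partial>lebesgue) + (\<integral>\<^sup>+x. ennreal (\<bar>g x\<bar> - l) \<partial>lebesgue)"
      by (rule nn_integral_add) measurable
    moreover have "ennreal (t * (k + l)) = ennreal (t * k) + ennreal (t * l)"
      using k l t by (simp add: distrib_left ennreal_plus)
    ultimately show ?thesis
      unfolding nn_integral_min_dist_fun_eq[OF f t k] nn_integral_min_dist_fun_eq[OF g t l]
      by (simp add: ac_simps)
  qed
  finally have "ennreal (1 / t) * (\<integral>\<^sup>+u\<in>{0<..}. min (ennreal t) (dist_fun (\<lambda>x. f x + g x) u) \<partial>lborel)
      \<le> ennreal (1 / t) * ((\<integral>\<^sup>+u\<in>{0<..}. min (ennreal t) (dist_fun f u) \<partial>lborel) +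
      (\<integral>\<^sup>+u\<in>{0<..}. min (ennreal t) (dist_fun g u) \<partial>lborel))"
    by (rule mult_left_mono) simp
  then show ?thesis
    by (simp only: max_rearrangement_eq[OF _ t] f g borel_measurable_add distrib_left)
qed

section \<open>Homogeneity, vanishing and integral bounds\<close>

lemma rearrangement_cmult_le:
  assumes c: "c \<noteq> 0"
  shows "ennreal \<bar>c\<bar> * rearrangement f t \<le> rearrangement (\<lambda>x. c * f x) t"
  unfolding rearrangement_eq_dist_fun[of "\<lambda>x. c * f x"]
proof (rule Inf_greatest)
  fix y assume "y \<in> ennreal ` {s. 0 < s \<and> dist_fun (\<lambda>x. c * f x) s < ennreal t}"
  then obtain s where s: "y = ennreal s" "0 < s" "dist_fun (\<lambda>x. c * f x) s < ennreal t" by auto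
  have "dist_fun (\<lambda>x. c * f x) s = dist_fun f (s / \<bar>c\<bar>)"
    using c by (simp add: dist_fun_def abs_mult field_simps)
  then have "rearrangement f t \<le> ennreal (s / \<bar>c\<bar>)"
    using s c by (intro rearrangement_le_ennreal) auto
  then have "ennreal \<bar>c\<bar> * rearrangement f t \<le> ennreal \<bar>c\<bar> * ennreal (s / \<bar>c\<bar>)"
    by (rule mult_left_mono) simp
  also have "\<dots> = y"
    using s c by (simp add: ennreal_mult[symmetric])
  finally show "ennreal \<bar>c\<bar> * rearrangement f t \<le> y" .
qed

lemma rearrangement_cmult:
  assumes c: "c \<noteq> 0"
  shows "rearrangement (\<lambda>x. c * f x) t = ennreal \<bar>c\<bar> * rearrangement f t"
proof (rule antisym)
  \<comment> \<open>The reverse inequality is \<open>rearrangement_cmult_le\<close> with the factor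
    1/c, applied to the function c f.\<close>
  have "rearrangement (\<lambda>x. c * f x) t =
      ennreal \<bar>c\<bar> * (ennreal \<bar>1 / c\<bar> * rearrangement (\<lambda>x. c * f x) t)"
    using c by (simp add: mult.assoc[symmetric] ennreal_mult[symmetric])
  also have "\<dots> \<le> ennreal \<bar>c\<bar> * rearrangement (\<lambda>x. 1 / c * (c * f x)) t"
    using c by (intro mult_left_mono rearrangement_cmult_le) auto
  also have "\<dots> = ennreal \<bar>c\<bar> * rearrangement f t"
    using c by simp
  finally show "rearrangement (\<lambda>x. c * f x) t \<le> ennreal \<bar>c\<bar> * rearrangement f t" .
qed (rule rearrangement_cmult_le[OF c])

lemma max_rearrangement_cmult:
  assumes "c \<noteq> 0"
  shows "max_rearrangement (\<lambda>x. c * f x) t = ennreal \<bar>c\<bar> * max_rearrangement f t"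
proof -
  have "(\<integral>\<^sup>+s\<in>{0<..t}. rearrangement (\<lambda>x. c * f x) s \<partial>lborel) =
      ennreal \<bar>c\<bar> * (\<integral>\<^sup>+s\<in>{0<..t}. rearrangement f s \<partial>lborel)"
    unfolding rearrangement_cmult[OF assms] mult.assoc by (rule nn_integral_cmult) measurable
  then show ?thesis by (simp add: max_rearrangement_def mult.left_commute)
qed

lemma rearrangement_eq_0:
  assumes "AE x in lebesgue. f x = 0" "0 < t"
  shows "rearrangement f t = 0"
proof -
  have "dist_fun f u = 0" if "0 < u" for u
  proof -
    have "AE x in lebesgue. \<not> u < \<bar>f x\<bar>"
      using assms(1) by eventually_elim (use that in simp)
    from emeasure_eq_0_AE[OF this] show ?thesis by (simp add: dist_fun_def)
  qed
  then have le: "rearrangement f t \<le> ennreal u" if "0 < u" for u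
    using that \<open>0 < t\<close> by (intro rearrangement_le_ennreal) auto
  have "rearrangement f t \<le> 0"
    by (rule ennreal_le_epsilon) (use le in auto)
  then show ?thesis by simp
qed

text \<open>If mu_f(0) were positive, any positive \<open>t\<close> below it would give f*(t) >
  0.\<close>

lemma AE_eq_0_of_rearrangement:
  assumes f: "f \<in> borel_measurable lebesgue" and 0: "\<And>t. 0 < t \<Longrightarrow> rearrangement f t = 0"
  shows "AE x in lebesgue. f x = 0"
proof -
  have "\<not> 0 < dist_fun f 0"
  proof
    assume "0 < dist_fun f 0"
    then obtain y where y: "0 < y" "y < dist_fun f 0" using dense by blast
    then obtain t where "y = ennreal t" "0 < t"
      by (cases y) (auto simp: ennreal_less_zero_iff)
    then have "ennreal 0 < rearrangement f t"
      using y by (intro less_rearrangement_of_less_dist_fun f) auto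
    with 0[OF \<open>0 < t\<close>] show False by simp
  qed
  then have "{x. 0 < \<bar>f x\<bar>} \<in> null_sets lebesgue"
    using superlevel_measurable[OF f, of 0] by (simp add: dist_fun_def null_sets_def)
  then show ?thesis
    by (intro AE_I'[of "{x. 0 < \<bar>f x\<bar>}"]) auto
qed

text \<open>The distribution function of the indicator equals \<open>m\<close> on (0,1) and vanishes
  from 1 on, so t f**(t) is at most min t m.\<close>

lemma max_rearrangement_indicator_le:
  assumes E: "E \<in> sets lebesgue" and m: "emeasure lebesgue E = ennreal m" "0 \<le> m" and t: "0 < t"
  shows "max_rearrangement (indicator E :: real ^ 'n \<Rightarrow> real) t \<le> ennreal (min t m / t)"
proof -
  have "(\<integral>\<^sup>+u\<in>{0<..}. min (ennreal t) (dist_fun (indicator E :: real ^ 'n \<Rightarrow> real) u) \<partial>lborel)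
      \<le> (\<integral>\<^sup>+u. ennreal (min t m) * indicator {0<..1::real} u \<partial>lborel)"
  proof (intro nn_integral_mono)
    fix u :: real
    have "{x. u < \<bar>indicator E x :: real\<bar>} = (if u < 1 then E else {})" if "0 < u"
      using that by (auto split: split_indicator_asm)
    then show "min (ennreal t) (dist_fun (indicator E :: real ^ 'n \<Rightarrow> real) u) * indicator {0<..} u
        \<le> ennreal (min t m) * indicator {0<..1} u"
      using m t by (auto split: split_indicator simp: dist_fun_def min_ennreal)
  qed
  also have "\<dots> = ennreal (min t m)" by (simp add: nn_integral_cmult_indicator)
  finally have "max_rearrangement (indicator E :: real ^ 'n \<Rightarrow> real) t
      \<le> ennreal (1 / t) * ennreal (min t m)"
    unfolding max_rearrangement_eq[OF borel_measurable_indicator[OF E] t] by (rule mult_left_mono) simp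
  then show ?thesis using t m by (simp add: ennreal_mult[symmetric])
qed

text \<open>The distribution function of \<open>f\<close> restricted to \<open>E\<close> is bounded
  both by the measure of \<open>E\<close> and by mu_f. Taking \<open>t\<close> as an upper bound for
  that measure covers null sets as well.\<close>

lemma set_nn_integral_le_max_rearrangement:
  assumes f[measurable]: "f \<in> borel_measurable lebesgue" and E[measurable]: "E \<in> sets lebesgue"
    and t: "emeasure lebesgue E \<le> ennreal t" "0 < t"
  shows "(\<integral>\<^sup>+x\<in>E. ennreal \<bar>f x\<bar> \<partial>lebesgue) \<le> ennreal t * max_rearrangement f t"
proof -
  let ?g = "\<lambda>x. f x * indicator E x"
  have g: "?g \<in> borel_measurable lebesgue" by measurable
  have "(\<integral>\<^sup>+x\<in>E. ennreal \<bar>f x\<bar> \<partial>lebesgue) = (\<integral>\<^sup>+x. ennreal (\<bar>?g x\<bar> - 0) \<partial>lebesgue)"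
    by (intro nn_integral_cong) (auto split: split_indicator)
  also have "\<dots> = (\<integral>\<^sup>+u\<in>{0<..}. dist_fun ?g u \<partial>lborel)"
    by (intro nn_integral_excess g) simp
  also have "\<dots> \<le> (\<integral>\<^sup>+u\<in>{0<..}. min (ennreal t) (dist_fun f u) \<partial>lborel)"
  proof (intro nn_integral_mono)
    fix u :: real
    have "dist_fun ?g u \<le> emeasure lebesgue E" if "0 < u"
      unfolding dist_fun_def using that by (intro emeasure_mono) (auto split: split_indicator_asm)
    moreover have "dist_fun ?g u \<le> dist_fun f u"
      by (intro dist_fun_mono g f) (auto split: split_indicator)
    ultimately show "dist_fun ?g u * indicator {0<..} u \<le> min (ennreal t) (dist_fun f u) * indicator {0<..} u"
      using t(1) by (auto split: split_indicator intro: order_trans)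
  qed
  also have "\<dots> = ennreal t * max_rearrangement f t"
    using t(2) by (simp add: max_rearrangement_eq[OF f] mult.assoc[symmetric] ennreal_mult[symmetric])
  finally show ?thesis .
qed

lemma max_rearrangement_mono:
  assumes "\<And>u. 0 < u \<Longrightarrow> dist_fun f u \<le> dist_fun g u"
  shows "max_rearrangement f t \<le> max_rearrangement g t"
  unfolding max_rearrangement_def using assms
  by (intro mult_left_mono nn_integral_mono mult_right_mono rearrangement_mono) auto

text \<open>Capping at \<open>t\<close> commutes with suprema, so monotone convergence can be
  applied to the formula for f** in terms of mu_f.\<close>

lemma max_rearrangement_SUP:
  assumes F: "\<And>k::nat. F k \<in> borel_measurable lebesgue" and f: "f \<in> borel_measurable lebesgue"
    and mono: "\<And>u k. 0 < u \<Longrightarrow> dist_fun (F k) u \<le> dist_fun (F (Suc k)) u"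
    and sup: "\<And>u. 0 < u \<Longrightarrow> dist_fun f u = (SUP k. dist_fun (F k) u)"
    and t: "0 < t"
  shows "max_rearrangement f t = (SUP k. max_rearrangement (F k) t)"
proof -
  let ?g = "\<lambda>k u. min (ennreal t) (dist_fun (F k) u) * indicator {0<..} u"
  have "(\<integral>\<^sup>+u\<in>{0<..}. min (ennreal t) (dist_fun f u) \<partial>lborel) = (\<integral>\<^sup>+u. (SUP k. ?g k u) \<partial>lborel)"
  proof (intro nn_integral_cong)
    fix u :: real
    show "min (ennreal t) (dist_fun f u) * indicator {0<..} u = (SUP k. ?g k u)"
    proof (cases "0 < u")
      case True
      have "min (ennreal t) (dist_fun f u) = (SUP k. min (ennreal t) (dist_fun (F k) u))"
        unfolding sup[OF True] inf_min[symmetric] by (rule inf_SUP)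
      then show ?thesis using True by simp
    qed simp
  qed
  also have "\<dots> = (SUP k. \<integral>\<^sup>+u. ?g k u \<partial>lborel)"
  proof (rule nn_integral_monotone_convergence_SUP)
    show "incseq ?g"
      by (intro incseq_SucI le_funI) (auto split: split_indicator intro: min.coboundedI2 mono)
    show "?g k \<in> borel_measurable lborel" for k
      using dist_fun_measurable[OF F, of k] by measurable
  qed
  finally have "max_rearrangement f t = ennreal (1 / t) * (SUP k. \<integral>\<^sup>+u. ?g k u \<partial>lborel)"
    by (simp add: max_rearrangement_eq[OF f t])
  also have "\<dots> = (SUP k. ennreal (1 / t) * (\<integral>\<^sup>+u. ?g k u \<partial>lborel))"
    by (rule SUP_mult_left_ennreal)
  also have "\<dots> = (SUP k. max_rearrangement (F k) t)"
    by (simp add: max_rearrangement_eq[OF F t])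
  finally show ?thesis .
qed

section \<open>The norm of weak \<open>L\<^sup>p\<close>\<close>

lemma weak_Lp_norm_upper:
  "0 < t \<Longrightarrow> ennreal (t powr (1 / p)) * max_rearrangement f t \<le> weak_Lp_norm p f"
  unfolding weak_Lp_norm_def by (intro SUP_upper) simp

text \<open>This turns the bound by t f**(t) into one by the norm, by splitting t into the powers
  with exponents 1 - 1/p and 1/p. It yields both the local integrability axiom and the bound on the
  maximal function.\<close>

lemma set_nn_integral_le_weak_Lp_norm:
  assumes f: "f \<in> borel_measurable lebesgue" and E: "E \<in> sets lebesgue"
    and t: "emeasure lebesgue E \<le> ennreal t" "0 < t"
  shows "(\<integral>\<^sup>+x\<in>E. ennreal \<bar>f x\<bar> \<partial>lebesgue) \<le> ennreal (t powr (1 - 1 / p)) * weak_Lp_norm p f"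
proof -
  have "(\<integral>\<^sup>+x\<in>E. ennreal \<bar>f x\<bar> \<partial>lebesgue) \<le> ennreal t * max_rearrangement f t"
    by (rule set_nn_integral_le_max_rearrangement[OF f E t])
  also have "ennreal t = ennreal (t powr (1 - 1 / p)) * ennreal (t powr (1 / p))"
    using t(2) by (simp add: powr_add[symmetric] ennreal_mult[symmetric])
  also have "\<dots> * max_rearrangement f t
      = ennreal (t powr (1 - 1 / p)) * (ennreal (t powr (1 / p)) * max_rearrangement f t)"
    by (rule mult.assoc)
  also have "\<dots> \<le> ennreal (t powr (1 - 1 / p)) * weak_Lp_norm p f"
    using t(2) by (intro mult_left_mono weak_Lp_norm_upper) auto
  finally show ?thesis .
qed

lemma weak_Lp_norm_eq_0_iff:
  assumes f: "f \<in> borel_measurable lebesgue"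
  shows "weak_Lp_norm p f = 0 \<longleftrightarrow> (AE x in lebesgue. f x = 0)"
proof
  assume 0: "weak_Lp_norm p f = 0"
  show "AE x in lebesgue. f x = 0"
  proof (rule AE_eq_0_of_rearrangement[OF f])
    fix t :: real assume t: "0 < t"
    have "ennreal (t powr (1 / p)) * max_rearrangement f t = 0"
      using weak_Lp_norm_upper[OF t, of p f] 0 by simp
    then show "rearrangement f t = 0"
      using rearrangement_le_max_rearrangement[OF t, of f] t by (simp add: ennreal_eq_0_iff)
  qed
next
  assume 0: "AE x in lebesgue. f x = 0"
  have "max_rearrangement f t = 0" if "0 < t" for t
  proof -
    have "(\<integral>\<^sup>+s\<in>{0<..t}. rearrangement f s \<partial>lborel) = (\<integral>\<^sup>+s. 0 \<partial>(lborel :: real measure))"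
      by (intro nn_integral_cong) (auto split: split_indicator simp: rearrangement_eq_0[OF 0])
    then show ?thesis by (simp add: max_rearrangement_def)
  qed
  then show "weak_Lp_norm p f = 0"
    unfolding weak_Lp_norm_def by (simp add: SUP_eq_const)
qed

lemma weak_Lp_norm_indicator_finite:
  assumes p: "1 < p" and E: "E \<in> sets lebesgue" "emeasure lebesgue E < \<infinity>"
  shows "weak_Lp_norm p (indicator E :: real ^ 'n \<Rightarrow> real) < \<infinity>"
proof -
  obtain m where m: "emeasure lebesgue E = ennreal m" "0 \<le> m"
    using E(2) by (cases "emeasure lebesgue E") auto
  \<comment> \<open>For t \<le> 1 both factors are at most 1; for t > 1 the power is at most
    \<open>t\<close>, which leaves min t m \<le> m.\<close>
  have "weak_Lp_norm p (indicator E :: real ^ 'n \<Rightarrow> real) \<le> ennreal (max 1 m)"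
    unfolding weak_Lp_norm_def
  proof (rule SUP_least)
    fix t :: real assume "t \<in> {0<..}"
    then have t: "0 < t" by simp
    have "ennreal (t powr (1 / p)) * max_rearrangement (indicator E :: real ^ 'n \<Rightarrow> real) t
        \<le> ennreal (t powr (1 / p)) * ennreal (min t m / t)"
      by (intro mult_left_mono max_rearrangement_indicator_le E m t) simp
    also have "\<dots> = ennreal (t powr (1 / p) * (min t m / t))"
      using m t by (simp add: ennreal_mult[symmetric])
    also have "\<dots> \<le> ennreal (max 1 m)"
    proof (rule ennreal_leI)
      show "t powr (1 / p) * (min t m / t) \<le> max 1 m"
      proof (cases "t \<le> 1")
        case True
        have "t powr (1 / p) \<le> 1" using True t p by (intro powr_le1) auto
        moreover have "min t m / t \<le> 1" using t by simp
        ultimately have "t powr (1 / p) * (min t m / t) \<le> 1 * 1"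
          using t m by (intro mult_mono) auto
        then show ?thesis by simp
      next
        case False
        have "t powr (1 / p) \<le> t powr 1" using False p by (intro powr_mono) auto
        then have "t powr (1 / p) * (min t m / t) \<le> t * (min t m / t)"
          using t m by (intro mult_right_mono) auto
        also have "\<dots> \<le> m" using t by simp
        finally show ?thesis by simp
      qed
    qed
    finally show "ennreal (t powr (1 / p)) * max_rearrangement (indicator E :: real ^ 'n \<Rightarrow> real) t \<le> ennreal (max 1 m)" .
  qed
  then show ?thesis by (rule le_less_trans) simp
qed

lemma weak_Lp_norm_fatou:
  assumes F: "\<And>k::nat. F k \<in> borel_measurable lebesgue" and f: "f \<in> borel_measurable lebesgue"
    and conv: "AE x in lebesgue. (\<forall>k. 0 \<le> F k x \<and> F k x \<le> F (Suc k) x) \<and> (\<lambda>k. F k x) \<longlonglongrightarrow> f x"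
  shows "(\<lambda>k. weak_Lp_norm p (F k)) \<longlonglongrightarrow> weak_Lp_norm p f"
proof -
  have mono: "AE x in lebesgue. \<forall>k. \<bar>F k x\<bar> \<le> \<bar>F (Suc k) x\<bar>"
    using conv by eventually_elim (auto intro: order_trans)
  have dist_mono: "dist_fun (F k) u \<le> dist_fun (F (Suc k)) u" for k u
    by (intro dist_fun_mono F) (use mono in eventually_elim, simp)
  \<comment> \<open>Strictness of the level matters: a value above \<open>u\<close> in the limit is
    already exceeded at a finite stage, whereas a value equal to \<open>u\<close> need not be
    reached.\<close>
  have sup: "AE x in lebesgue. u < \<bar>f x\<bar> \<longleftrightarrow> (\<exists>k. u < \<bar>F k x\<bar>)" for u
    using conv
  proof eventually_elim
    case (elim x)
    then have inc: "incseq (\<lambda>k. F k x)" and lim: "(\<lambda>k. F k x) \<longlonglongrightarrow> f x"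
      and pos: "\<And>k. 0 \<le> F k x"
      by (auto intro: incseq_SucI)
    have le: "F k x \<le> f x" for k by (rule incseq_le[OF inc lim])
    have pos': "0 \<le> f x" using le[of 0] pos[of 0] by simp
    show ?case
    proof
      assume "u < \<bar>f x\<bar>"
      then have "eventually (\<lambda>k. u < F k x) sequentially"
        using pos' by (intro order_tendstoD(1)[OF lim]) simp
      then show "\<exists>k. u < \<bar>F k x\<bar>" using pos by (auto simp: eventually_sequentially)
    next
      assume "\<exists>k. u < \<bar>F k x\<bar>"
      then obtain k where "u < F k x" using pos by auto
      then show "u < \<bar>f x\<bar>" using le[of k] pos' by simp
    qed
  qed
  have "weak_Lp_norm p f =
      (SUP t\<in>{0<..}. SUP k. ennreal (t powr (1 / p)) * max_rearrangement (F k) t)"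
    unfolding weak_Lp_norm_def
  proof (rule SUP_cong[OF refl])
    fix t :: real assume "t \<in> {0<..}"
    then have "max_rearrangement f t = (SUP k. max_rearrangement (F k) t)"
      by (intro max_rearrangement_SUP F f dist_mono dist_fun_SUP mono sup) auto
    then show "ennreal (t powr (1 / p)) * max_rearrangement f t =
        (SUP k. ennreal (t powr (1 / p)) * max_rearrangement (F k) t)"
      by (simp add: SUP_mult_left_ennreal)
  qed
  \<comment> \<open>The norm is a supremum over \<open>t\<close>, so no uniformity in
    \<open>t\<close> is needed: the two suprema are exchanged.\<close>
  also have "\<dots> = (SUP k. weak_Lp_norm p (F k))"
    unfolding weak_Lp_norm_def by (rule SUP_commute)
  finally show ?thesis
    by (simp, intro LIMSEQ_SUP incseq_SucI)
       (auto simp: weak_Lp_norm_def intro!: SUP_mono' mult_left_mono max_rearrangement_mono dist_mono)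
qed

lemma ri_norm_weak_Lp_norm:
  assumes p: "1 < p"
  shows "ri_norm (weak_Lp_norm p :: (real ^ 'n \<Rightarrow> real) \<Rightarrow> ennreal)"
proof
  fix f g :: "real ^ 'n \<Rightarrow> real" and c :: real and E :: "(real ^ 'n) set" and F :: "nat \<Rightarrow> real ^ 'n \<Rightarrow> real"
  show "weak_Lp_norm p f = 0 \<longleftrightarrow> (AE x in lebesgue. f x = 0)" if "f \<in> borel_measurable lebesgue"
    by (rule weak_Lp_norm_eq_0_iff[OF that])
  show "weak_Lp_norm p (\<lambda>x. c * f x) = ennreal \<bar>c\<bar> * weak_Lp_norm p f" if "f \<in> borel_measurable lebesgue"
  proof (cases "c = 0")
    case True
    have "weak_Lp_norm p (\<lambda>x :: real ^ 'n. 0) = 0" by (subst weak_Lp_norm_eq_0_iff) auto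
    then show ?thesis using True by simp
  next
    case False
    then show ?thesis
      by (simp add: weak_Lp_norm_def max_rearrangement_cmult SUP_mult_left_ennreal mult.left_commute)
  qed
  show "weak_Lp_norm p (\<lambda>x. f x + g x) \<le> weak_Lp_norm p f + weak_Lp_norm p g"
    if f: "f \<in> borel_measurable lebesgue" and g: "g \<in> borel_measurable lebesgue"
    unfolding weak_Lp_norm_def[of p "\<lambda>x. f x + g x"]
  proof (rule SUP_least)
    fix t :: real assume "t \<in> {0<..}"
    then have t: "0 < t" by simp
    have "ennreal (t powr (1 / p)) * max_rearrangement (\<lambda>x. f x + g x) t \<le>
        ennreal (t powr (1 / p)) * (max_rearrangement f t + max_rearrangement g t)"
      by (intro mult_left_mono max_rearrangement_add_le f g t) simp
    also have "\<dots> \<le> weak_Lp_norm p f + weak_Lp_norm p g"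
      unfolding distrib_left by (intro add_mono weak_Lp_norm_upper t)
    finally show "ennreal (t powr (1 / p)) * max_rearrangement (\<lambda>x. f x + g x) t
        \<le> weak_Lp_norm p f + weak_Lp_norm p g" .
  qed
  show "weak_Lp_norm p f \<le> weak_Lp_norm p g"
    if "f \<in> borel_measurable lebesgue" "g \<in> borel_measurable lebesgue" "AE x in lebesgue. \<bar>f x\<bar> \<le> \<bar>g x\<bar>"
    unfolding weak_Lp_norm_def using that
    by (intro SUP_mono' mult_left_mono max_rearrangement_mono dist_fun_mono) auto
  show "(\<lambda>k. weak_Lp_norm p (F k)) \<longlonglongrightarrow> weak_Lp_norm p f"
    if "\<And>k. F k \<in> borel_measurable lebesgue" "f \<in> borel_measurable lebesgue"
      "AE x in lebesgue. (\<forall>k. 0 \<le> F k x \<and> F k x \<le> F (Suc k) x) \<and> (\<lambda>k. F k x) \<longlonglongrightarrow> f x"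
    by (rule weak_Lp_norm_fatou[OF that])
  show "weak_Lp_norm p (indicator E :: real ^ 'n \<Rightarrow> real) < \<infinity>"
    if "E \<in> sets lebesgue" "emeasure lebesgue E < \<infinity>"
    by (rule weak_Lp_norm_indicator_finite[OF p that])
  show "\<exists>C. \<forall>f\<in>borel_measurable lebesgue.
      (\<integral>\<^sup>+x\<in>E. ennreal \<bar>f x\<bar> \<partial>lebesgue) \<le> ennreal C * weak_Lp_norm p f"
    if E: "E \<in> sets lebesgue" "emeasure lebesgue E < \<infinity>"
  proof -
    obtain m where "emeasure lebesgue E = ennreal m" "0 \<le> m"
      using E(2) by (cases "emeasure lebesgue E") auto
    \<comment> \<open>The maximum with 1 keeps the parameter positive when \<open>E\<close> is a
      null set.\<close>
    then have "emeasure lebesgue E \<le> ennreal (max 1 m)" by (simp add: ennreal_leI)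
    from set_nn_integral_le_weak_Lp_norm[OF _ E(1) this] show ?thesis
      by (intro exI[of _ "max 1 m powr (1 - 1 / p)"]) auto
  qed
  show "weak_Lp_norm p f = weak_Lp_norm p g"
    if "\<forall>t>0. rearrangement f t = rearrangement g t"
  proof -
    have "(\<integral>\<^sup>+s\<in>{0<..t}. rearrangement f s \<partial>lborel) = (\<integral>\<^sup>+s\<in>{0<..t}. rearrangement g s \<partial>lborel)" for t
      using that by (intro nn_integral_cong) (auto split: split_indicator)
    then show ?thesis by (simp add: weak_Lp_norm_def max_rearrangement_def)
  qed
qed

section \<open>Equivalence of the f* and f** descriptions of weak \<open>L^p\<close>\<close>

lemma nn_integral_powr_neg:
  assumes "0 < t" "a < 1"
  shows "(\<integral>\<^sup>+s\<in>{0<..t}. ennreal (s powr - a) \<partial>lborel) = ennreal (t powr (1 - a) / (1 - a))"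
proof -
  have "((\<lambda>s. s powr - a) has_integral (t powr (1 - a) / (1 - a))) {0..t}"
    using has_integral_powr_from_0[of "- a" t] assms by (simp add: add.commute)
  from nn_integral_has_integral_lebesgue[OF _ this]
  have "(\<integral>\<^sup>+s\<in>{0..t}. ennreal (s powr - a) \<partial>lborel) = ennreal (t powr (1 - a) / (1 - a))"
    by (simp add: nn_integral_completion mult.commute nn_integral_set_ennreal)
  \<comment> \<open>The endpoint contributes nothing because \<open>0 powr - a\<close> is 0 by
    convention.\<close>
  moreover have "(\<integral>\<^sup>+s\<in>{0<..t}. ennreal (s powr - a) \<partial>lborel) = (\<integral>\<^sup>+s\<in>{0..t}. ennreal (s powr - a) \<partial>lborel)"
    by (intro nn_integral_cong) (auto split: split_indicator)
  ultimately show ?thesis by simp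
qed

lemma ri_space_weak_Lp_norm:
  assumes p: "1 < p"
  shows "ri_space (weak_Lp_norm p) = (weak_Lp p :: (real ^ 'n \<Rightarrow> real) set)"
proof (intro set_eqI iffI)
  fix f :: "real ^ 'n \<Rightarrow> real" assume "f \<in> ri_space (weak_Lp_norm p)"
  moreover have "(SUP t\<in>{0<..}. ennreal (t powr (1 / p)) * rearrangement f t) \<le> weak_Lp_norm p f"
    unfolding weak_Lp_norm_def
    by (rule SUP_subset_mono) (auto intro!: mult_left_mono rearrangement_le_max_rearrangement)
  ultimately show "f \<in> weak_Lp p"
    by (auto simp: ri_space_def weak_Lp_def intro: le_less_trans)
next
  fix f :: "real ^ 'n \<Rightarrow> real" assume f: "f \<in> weak_Lp p"
  then obtain M where M: "(SUP t\<in>{0<..}. ennreal (t powr (1 / p)) * rearrangement f t) = ennreal M" "0 \<le> M"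
    by (cases "SUP t\<in>{0<..}. ennreal (t powr (1 / p)) * rearrangement f t") (auto simp: weak_Lp_def)
  \<comment> \<open>For p > 1 this majorant is integrable at 0; averaging it over (0,t] costs
    exactly the factor 1 / (1 - 1/p).\<close>
  have bound: "rearrangement f s \<le> ennreal (M * s powr - (1 / p))" if s: "0 < s" for s
  proof -
    have "ennreal (s powr (1 / p)) * rearrangement f s \<le> ennreal M"
      unfolding M(1)[symmetric] using s by (intro SUP_upper) simp
    then have "ennreal (s powr - (1 / p)) * (ennreal (s powr (1 / p)) * rearrangement f s)
        \<le> ennreal (s powr - (1 / p)) * ennreal M"
      by (rule mult_left_mono) simp
    moreover have "ennreal (s powr - (1 / p)) * (ennreal (s powr (1 / p)) * rearrangement f s) = rearrangement f s"
      using s by (simp add: mult.assoc[symmetric] ennreal_mult[symmetric] powr_add[symmetric])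
    ultimately show ?thesis using M(2) by (simp add: ennreal_mult mult.commute)
  qed
  have "weak_Lp_norm p f \<le> ennreal (M / (1 - 1 / p))"
    unfolding weak_Lp_norm_def
  proof (rule SUP_least)
    fix t :: real assume "t \<in> {0<..}"
    then have t: "0 < t" by simp
    have "(\<integral>\<^sup>+s\<in>{0<..t}. rearrangement f s \<partial>lborel) \<le>
        (\<integral>\<^sup>+s. ennreal M * (ennreal (s powr - (1 / p)) * indicator {0<..t} s) \<partial>lborel)"
      using bound M(2) by (intro nn_integral_mono) (auto split: split_indicator simp: ennreal_mult)
    also have "\<dots> = ennreal M * ennreal (t powr (1 - 1 / p) / (1 - 1 / p))"
      using p t by (subst nn_integral_cmult) (auto simp: nn_integral_powr_neg)
    finally have "ennreal (t powr (1 / p)) * max_rearrangement f t \<le>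
        ennreal (t powr (1 / p)) * (ennreal (1 / t) * (ennreal M * ennreal (t powr (1 - 1 / p) / (1 - 1 / p))))"
      unfolding max_rearrangement_def by (intro mult_left_mono) auto
    also have "\<dots> = ennreal (t powr (1 / p) * (1 / t * (M * (t powr (1 - 1 / p) / (1 - 1 / p)))))"
    proof -
      have "0 \<le> 1 - 1 / p" using p by simp
      then show ?thesis using t M(2) by (simp only: ennreal_mult[symmetric] zero_le_mult_iff
            zero_le_divide_iff powr_ge_zero zero_le_one less_imp_le simp_thms)
    qed
    also have "t powr (1 / p) * (1 / t * (M * (t powr (1 - 1 / p) / (1 - 1 / p)))) = M / (1 - 1 / p)"
    proof -
      have "t powr (1 / p) * t powr (1 - 1 / p) = t"
        using t by (simp add: powr_add[symmetric])
      moreover have "t powr (1 / p) * (1 / t * (M * (t powr (1 - 1 / p) / (1 - 1 / p)))) =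
          (t powr (1 / p) * t powr (1 - 1 / p)) * (1 / t) * (M / (1 - 1 / p))"
        by (simp add: divide_inverse ac_simps)
      ultimately show ?thesis using t by simp
    qed
    finally show "ennreal (t powr (1 / p)) * max_rearrangement f t \<le> ennreal (M / (1 - 1 / p))" .
  qed
  then have "weak_Lp_norm p f < \<infinity>" by (rule le_less_trans) simp
  then show "f \<in> ri_space (weak_Lp_norm p)" using f by (simp add: ri_space_def weak_Lp_def)
qed

section \<open>The fractional maximal function\<close>

lemma measure_cube:
  fixes a b :: "real ^ 'n"
  assumes "0 \<le> l" "\<And>i. b $ i - a $ i = l"
  shows "measure lebesgue (cbox a b) = l ^ CARD('n)"
proof -
  have "a $ i \<le> b $ i" for i using assms(1) assms(2)[of i] by simp
  then have "cbox a b \<noteq> {}" by (simp add: interval_ne_empty_cart)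
  then show ?thesis by (simp add: assms(2) content_cbox_cart)
qed

lemma emeasure_cube:
  fixes a b :: "real ^ 'n"
  assumes "0 \<le> l" "\<And>i. b $ i - a $ i = l"
  shows "emeasure lebesgue (cbox a b) = ennreal (l ^ CARD('n))"
proof -
  have "emeasure lebesgue (cbox a b) \<noteq> top"
    using emeasure_lborel_cbox_finite[of a b] by simp
  then show ?thesis by (metis emeasure_eq_ennreal_measure measure_cube[OF assms])
qed

lemma cubesE:
  assumes "Q \<in> (cubes :: (real ^ 'n) set set)"
  obtains a b l where "Q = cbox a b" "0 < l" "\<And>i. b $ i - a $ i = l"
    "measure lebesgue Q = l ^ CARD('n)" "emeasure lebesgue Q = ennreal (l ^ CARD('n))" "Q \<in> sets lebesgue"
proof -
  obtain a b l where Q: "Q = cbox a b" "0 < l" "\<And>i. b $ i - a $ i = l"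
    using assms unfolding cubes_def by blast
  then show thesis
    using that measure_cube[of l b a] emeasure_cube[of l b a] by simp
qed

lemma cbox_in_cubes: "0 < l \<Longrightarrow> (\<And>i. b $ i - a $ i = l) \<Longrightarrow> cbox a b \<in> cubes"
  unfolding cubes_def by blast

lemma frac_maximal_upper:
  assumes "Q \<in> cubes" "x \<in> Q"
  shows "ennreal (measure lebesgue Q powr (\<alpha> / CARD('n)) * (1 / measure lebesgue Q)) *
        (\<integral>\<^sup>+y\<in>Q. ennreal \<bar>f y\<bar> \<partial>lebesgue) \<le> frac_maximal \<alpha> f (x :: real ^ 'n)"
  unfolding frac_maximal_def using assms by (intro SUP_upper) simp

text \<open>
  The cubes are closed, so openness is not immediate: a cube containing \<open>x\<close>, possibly on its
  boundary, has to be enlarged slightly.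
\<close>

lemma open_frac_maximal_superlevel:
  fixes f :: "real ^ 'n \<Rightarrow> real"
  shows "open {x. c < frac_maximal \<alpha> f x}"
proof (rule openI)
  fix x assume "x \<in> {x. c < frac_maximal \<alpha> f x}"
  then obtain Q where Q: "Q \<in> cubes" "x \<in> Q" and
    c: "c < ennreal (measure lebesgue Q powr (\<alpha> / CARD('n)) * (1 / measure lebesgue Q)) *
        (\<integral>\<^sup>+y\<in>Q. ennreal \<bar>f y\<bar> \<partial>lebesgue)"
    by (auto simp: frac_maximal_def less_SUP_iff)
  obtain a b l where ab: "Q = cbox a b" "0 < l" "\<And>i. b $ i - a $ i = l"
    "measure lebesgue Q = l ^ CARD('n)"
    using cubesE[OF Q(1)] by metis
  let ?I = "\<integral>\<^sup>+y\<in>Q. ennreal \<bar>f y\<bar> \<partial>lebesgue"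
  \<comment> \<open>The normalizing factor of the cube enlarged by \<epsilon> on every side. The
    integral stays over the original cube, so only this factor varies.\<close>
  define \<phi> where "\<phi> \<epsilon> = ((l + 2 * \<epsilon>) ^ CARD('n)) powr (\<alpha> / CARD('n)) * (1 / (l + 2 * \<epsilon>) ^ CARD('n))" for \<epsilon>
  have "(\<phi> \<longlongrightarrow> \<phi> 0) (at_right 0)"
    unfolding \<phi>_def using ab(2) by (intro tendsto_intros) auto
  \<comment> \<open>The integral may be infinite, and multiplication in \<open>ennreal\<close> is
    discontinuous at 0 times infinity; a positive limit factor avoids this.\<close>
  moreover have pos: "0 < \<phi> 0" using ab(2) by (simp add: \<phi>_def)
  ultimately have "((\<lambda>\<epsilon>. ennreal (\<phi> \<epsilon>) * ?I) \<longlongrightarrow> ennreal (\<phi> 0) * ?I) (at_right 0)"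
    by (intro tendsto_mult_ennreal tendsto_ennrealI tendsto_const) (auto simp: ennreal_eq_0_iff)
  moreover have "c < ennreal (\<phi> 0) * ?I" using c ab(4) by (simp add: \<phi>_def)
  ultimately have "eventually (\<lambda>\<epsilon>. c < ennreal (\<phi> \<epsilon>) * ?I) (at_right 0)"
    by (rule order_tendstoD(1))
  then have "eventually (\<lambda>\<epsilon>. c < ennreal (\<phi> \<epsilon>) * ?I \<and> 0 < \<epsilon>) (at_right 0)"
    by (intro eventually_conj eventually_at_right_less)
  then obtain \<epsilon> where \<epsilon>: "c < ennreal (\<phi> \<epsilon>) * ?I" "0 < \<epsilon>"
    using eventually_happens'[OF trivial_limit_at_right_real] by blast
  define Q' where "Q' = cbox (a - (\<chi> i. \<epsilon>)) (b + (\<chi> i. \<epsilon>))"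
  have side: "(b + (\<chi> i. \<epsilon>)) $ i - (a - (\<chi> i. \<epsilon>)) $ i = l + 2 * \<epsilon>" for i
    using ab(3)[of i] by simp
  have Q': "Q' \<in> cubes"
    unfolding Q'_def using side ab(2) \<epsilon>(2) by (intro cbox_in_cubes[of "l + 2 * \<epsilon>"]) auto
  have m': "measure lebesgue Q' = (l + 2 * \<epsilon>) ^ CARD('n)"
    unfolding Q'_def using side ab(2) \<epsilon>(2) by (intro measure_cube) auto
  have sub: "Q \<subseteq> Q'"
    unfolding Q'_def ab(1) using \<epsilon>(2) by (auto simp: mem_box_cart) (smt (verit))+
  have "ball x \<epsilon> \<subseteq> {x. c < frac_maximal \<alpha> f x}"
  proof
    fix y assume y: "y \<in> ball x \<epsilon>"
    have "y \<in> Q'"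
      unfolding Q'_def mem_box_cart
    proof
      fix i
      have "\<bar>x $ i - y $ i\<bar> < \<epsilon>"
        using y component_le_norm_cart[of "x - y" i] by (simp add: dist_norm)
      moreover have "a $ i \<le> x $ i" "x $ i \<le> b $ i"
        using Q(2) by (auto simp: ab(1) mem_box_cart)
      ultimately show "(a - (\<chi> i. \<epsilon>)) $ i \<le> y $ i \<and> y $ i \<le> (b + (\<chi> i. \<epsilon>)) $ i"
        by (auto simp: abs_less_iff)
    qed
    have "c < ennreal (\<phi> \<epsilon>) * ?I" by (rule \<epsilon>(1))
    also have "\<dots> \<le> ennreal (\<phi> \<epsilon>) * (\<integral>\<^sup>+y\<in>Q'. ennreal \<bar>f y\<bar> \<partial>lebesgue)"
      using sub by (intro mult_left_mono nn_integral_mono) (auto split: split_indicator)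
    also have "\<dots> \<le> frac_maximal \<alpha> f y"
      using frac_maximal_upper[OF Q' \<open>y \<in> Q'\<close>, of \<alpha> f] by (simp add: m' \<phi>_def)
    finally show "y \<in> {x. c < frac_maximal \<alpha> f x}" by simp
  qed
  then show "\<exists>e>0. ball x e \<subseteq> {x. c < frac_maximal \<alpha> f x}" using \<epsilon>(2) by blast
qed

text \<open>Needed since \<open>esssup\<close> of a non-measurable function is infinite; the open
  superlevel sets give Borel measurability.\<close>

lemma frac_maximal_measurable: "frac_maximal \<alpha> f \<in> borel_measurable lebesgue"
proof -
  have "frac_maximal \<alpha> f \<in> borel_measurable lborel"
    by (rule borel_measurableI_greater) (simp add: open_frac_maximal_superlevel borel_open)
  then show ?thesis by (rule measurable_completion)
qed

text \<open>With m the volume of the cube and 1/p = \<alpha>/n, the powers of m cancel exactly, so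
  the bound has constant 1 at every point.\<close>

lemma frac_maximal_le_weak_Lp_norm:
  fixes f :: "real ^ 'n \<Rightarrow> real"
  assumes f: "f \<in> borel_measurable lebesgue"
  shows "frac_maximal \<alpha> f x \<le> weak_Lp_norm (real CARD('n) / \<alpha>) f"
  unfolding frac_maximal_def
proof (rule SUP_least)
  fix Q :: "(real ^ 'n) set" assume "Q \<in> {Q \<in> cubes. x \<in> Q}"
  then obtain l where l: "0 < l" "measure lebesgue Q = l ^ CARD('n)"
    "emeasure lebesgue Q = ennreal (l ^ CARD('n))" "Q \<in> sets lebesgue"
    by (auto elim: cubesE)
  define m where "m = l ^ CARD('n)"
  have m: "0 < m" using l by (simp add: m_def)
  have "(\<integral>\<^sup>+y\<in>Q. ennreal \<bar>f y\<bar> \<partial>lebesgue) \<le>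
      ennreal (m powr (1 - 1 / (real CARD('n) / \<alpha>))) * weak_Lp_norm (real CARD('n) / \<alpha>) f"
    using l m by (intro set_nn_integral_le_weak_Lp_norm f) (auto simp: m_def)
  then have "ennreal (m powr (\<alpha> / CARD('n)) * (1 / m)) * (\<integral>\<^sup>+y\<in>Q. ennreal \<bar>f y\<bar> \<partial>lebesgue) \<le>
      ennreal (m powr (\<alpha> / CARD('n)) * (1 / m)) *
      (ennreal (m powr (1 - 1 / (real CARD('n) / \<alpha>))) * weak_Lp_norm (real CARD('n) / \<alpha>) f)"
    by (rule mult_left_mono) simp
  also have "\<dots> = ennreal (m powr (\<alpha> / CARD('n)) * (1 / m) * m powr (1 - \<alpha> / CARD('n))) *
      weak_Lp_norm (real CARD('n) / \<alpha>) f"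
    using m by (simp only: mult.assoc[symmetric], subst ennreal_mult) auto
  also have "m powr (\<alpha> / CARD('n)) * (1 / m) * m powr (1 - \<alpha> / CARD('n)) = 1"
  proof -
    have "m powr (\<alpha> / CARD('n)) * m powr (1 - \<alpha> / CARD('n)) = m"
      using m by (simp add: powr_add[symmetric])
    then show ?thesis using m by (simp add: field_simps)
  qed
  finally show "ennreal (measure lebesgue Q powr (\<alpha> / CARD('n)) * (1 / measure lebesgue Q)) *
      (\<integral>\<^sup>+y\<in>Q. ennreal \<bar>f y\<bar> \<partial>lebesgue) \<le> weak_Lp_norm (real CARD('n) / \<alpha>) f"
    by (simp add: l(2) m_def)
qed

lemma frac_maximal_bounded_weak_Lp_norm:
  "frac_maximal_bounded \<alpha> (weak_Lp_norm (real CARD('n) / \<alpha>) :: (real ^ 'n \<Rightarrow> real) \<Rightarrow> ennreal)"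
  unfolding frac_maximal_bounded_def
proof (intro exI[of _ 1] ballI)
  fix f :: "real ^ 'n \<Rightarrow> real" assume "f \<in> ri_space (weak_Lp_norm (real CARD('n) / \<alpha>))"
  then show "esssup lebesgue (frac_maximal \<alpha> f) \<le> ennreal 1 * weak_Lp_norm (real CARD('n) / \<alpha>) f"
    by (auto simp: ri_space_def intro!: frac_maximal_measurable frac_maximal_le_weak_Lp_norm)
qed

section \<open>From boundedness of the maximal operator to inclusion in
  \<open>X_space\<close>\<close>

lemma (in ri_norm) ri_space_subset_L1_loc: "ri_space \<rho> \<subseteq> L1_loc"
proof
  fix f assume "f \<in> ri_space \<rho>"
  then have f[measurable]: "f \<in> borel_measurable lebesgue" and fin: "\<rho> f < \<infinity>"
    by (auto simp: ri_space_def)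
  show "f \<in> L1_loc"
    unfolding L1_loc_def
  proof (intro CollectI conjI allI impI f)
    fix K :: "(real ^ 'n) set" assume K: "compact K"
    have [measurable]: "K \<in> sets lebesgue" using K by (simp add: lmeasurable_compact fmeasurableD)
    have "emeasure lebesgue K < \<infinity>"
      using lmeasurable_compact[OF K] by (simp add: fmeasurable_def)
    then obtain C where "\<forall>f\<in>borel_measurable lebesgue.
        (\<integral>\<^sup>+x\<in>K. ennreal \<bar>f x\<bar> \<partial>lebesgue) \<le> ennreal C * \<rho> f"
      using local_integral_bound[of K] by auto
    then have "(\<integral>\<^sup>+x\<in>K. ennreal \<bar>f x\<bar> \<partial>lebesgue) \<le> ennreal C * \<rho> f"
      using f by (rule bspec)
    also have "\<dots> < \<infinity>" using fin by (simp add: ennreal_mult_less_top)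
    also have "(\<integral>\<^sup>+x\<in>K. ennreal \<bar>f x\<bar> \<partial>lebesgue) =
        (\<integral>\<^sup>+x. ennreal (norm (indicator K x *\<^sub>R f x)) \<partial>lebesgue)"
      by (intro nn_integral_cong) (auto split: split_indicator)
    finally have "(\<integral>\<^sup>+x. ennreal (norm (indicator K x *\<^sub>R f x)) \<partial>lebesgue) < \<infinity>" .
    then show "set_integrable lebesgue K f"
      unfolding set_integrable_def by (intro integrableI_bounded) measurable
  qed
qed

lemma (in ri_norm) ri_space_subset_X_space:
  assumes "frac_maximal_bounded \<alpha> \<rho>"
  shows "ri_space \<rho> \<subseteq> X_space \<alpha>"
proof
  fix f assume f: "f \<in> ri_space \<rho>"
  obtain C where "esssup lebesgue (frac_maximal \<alpha> f) \<le> ennreal C * \<rho> f"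
    using assms f unfolding frac_maximal_bounded_def by blast
  also have "\<dots> < \<infinity>" using f by (simp add: ri_space_def ennreal_mult_less_top)
  finally show "f \<in> X_space \<alpha>"
    using f ri_space_subset_L1_loc by (auto simp: X_space_def)
qed

section \<open>Optimality\<close>

text \<open>The volume of the smallest cube centred at the origin containing \<open>x\<close>.\<close>

definition cube_volume :: "real ^ 'n \<Rightarrow> real" where
  "cube_volume x = (2 * infnorm x) ^ CARD('n)"

lemma cube_volume_nonneg [simp]: "0 \<le> cube_volume x"
  by (simp add: cube_volume_def infnorm_pos_le)

lemma cube_volume_pos_iff [simp]: "0 < cube_volume x \<longleftrightarrow> x \<noteq> 0"
  using infnorm_pos_lt[of x] infnorm_pos_le[of x] by (auto simp: cube_volume_def infnorm_0 power_0_left)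

lemma cube_volume_measurable [measurable]: "cube_volume \<in> borel_measurable lebesgue"
proof -
  have "cube_volume \<in> borel_measurable borel"
    unfolding cube_volume_def by (intro borel_measurable_continuous_onI continuous_intros)
  then show ?thesis by (intro measurable_completion) simp
qed

lemma infnorm_le_iff_cart: "infnorm (x :: real ^ 'n) \<le> r \<longleftrightarrow> (\<forall>i. \<bar>x $ i\<bar> \<le> r)"
proof
  assume "\<forall>i. \<bar>x $ i\<bar> \<le> r"
  then show "infnorm x \<le> r" unfolding infnorm_cart by (intro cSup_least) auto
qed (auto intro: order_trans[OF component_le_infnorm_cart])

lemma cube_volume_le_eq_cbox:
  assumes "0 \<le> s"
  obtains r where "0 \<le> r" "(2 * r) ^ CARD('n) = s"
    "{x :: real ^ 'n. cube_volume x \<le> s} = cbox (\<chi> i. - r) (\<chi> i. r)"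
proof -
  \<comment> \<open>Half the side length of a cube of volume \<open>s\<close>.\<close>
  define r where "r = root CARD('n) s / 2"
  have r: "0 \<le> r" "(2 * r) ^ CARD('n) = s"
    using assms by (auto simp: r_def)
  have "cube_volume x \<le> s \<longleftrightarrow> infnorm x \<le> r" for x :: "real ^ 'n"
    unfolding cube_volume_def r(2)[symmetric] using r(1)
    by (subst power_mono_iff) (auto simp: infnorm_pos_le)
  then have "{x :: real ^ 'n. cube_volume x \<le> s} = cbox (\<chi> i. - r) (\<chi> i. r)"
    by (auto simp: infnorm_le_iff_cart mem_box_cart abs_le_iff minus_le_iff)
  with r show thesis by (rule that)
qed

lemma cube_volume_le_measurable [measurable]: "{x. cube_volume x \<le> s} \<in> sets lebesgue"
  using measurable_sets[OF cube_volume_measurable, of "{..s}"] by (simp add: vimage_def)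

text \<open>Thus \<open>cube_volume\<close> carries Lebesgue measure to length on the half-line,
  which makes f* composed with it equimeasurable with f*.\<close>

lemma emeasure_cube_volume_le:
  assumes "0 \<le> s"
  shows "emeasure lebesgue {x :: real ^ 'n. cube_volume x \<le> s} = ennreal s"
proof -
  obtain r where r: "0 \<le> r" "(2 * r) ^ CARD('n) = s"
    "{x :: real ^ 'n. cube_volume x \<le> s} = cbox (\<chi> i. - r) (\<chi> i. r)"
    using cube_volume_le_eq_cbox[OF assms] .
  have "emeasure lebesgue (cbox (\<chi> i. - r) (\<chi> i. r) :: (real ^ 'n) set) = ennreal ((2 * r) ^ CARD('n))"
    using r(1) by (intro emeasure_cube) auto
  then show ?thesis unfolding r(2,3) .
qed

lemma cube_volume_le_in_cubes:
  assumes "0 < s"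
  shows "{x :: real ^ 'n. cube_volume x \<le> s} \<in> cubes"
proof -
  obtain r where r: "0 \<le> r" "(2 * r) ^ CARD('n) = s"
    "{x :: real ^ 'n. cube_volume x \<le> s} = cbox (\<chi> i. - r) (\<chi> i. r)"
    using cube_volume_le_eq_cbox[of s] assms by auto
  have "r \<noteq> 0" using r(2) assms by (auto simp: power_0_left)
  then show ?thesis unfolding r(3) using r(1) by (intro cbox_in_cubes[of "2 * r"]) auto
qed

text \<open>The function g of the overview, made real-valued. \<open>enn2real\<close> sends infinity
  to 0, so it represents f* faithfully only where f* is finite; at the origin f*(0) is the infimum
  of the empty set and the value is 0.\<close>

definition radial_rearrangement :: "(real ^ 'n \<Rightarrow> real) \<Rightarrow> real ^ 'n \<Rightarrow> real" where
  "radial_rearrangement f x = enn2real (rearrangement f (cube_volume x))"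

lemma radial_rearrangement_measurable [measurable]: "radial_rearrangement f \<in> borel_measurable lebesgue"
  unfolding radial_rearrangement_def by measurable

text \<open>The superlevel set at \<open>u\<close> lies in the centred cube of volume mu_f(u), if
  that is finite, and contains every centred cube of smaller volume up to the origin.\<close>

lemma dist_fun_radial_rearrangement:
  fixes f :: "real ^ 'n \<Rightarrow> real"
  assumes f: "f \<in> borel_measurable lebesgue" and fin: "\<And>t. 0 < t \<Longrightarrow> rearrangement f t < top"
    and u: "0 < u"
  shows "dist_fun (radial_rearrangement f) u = dist_fun f u"
proof (rule antisym)
  show "dist_fun (radial_rearrangement f) u \<le> dist_fun f u"
  proof (cases "dist_fun f u")
    case (real m)
    have "cube_volume x \<le> m" if "u < \<bar>radial_rearrangement f x\<bar>" for x
    proof -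
      have "ennreal u < rearrangement f (cube_volume x)"
        using that u by (cases "rearrangement f (cube_volume x)")
          (auto simp: radial_rearrangement_def ennreal_less_iff)
      from dist_fun_ge_of_less_rearrangement[OF u this] show ?thesis using real by simp
    qed
    then have "dist_fun (radial_rearrangement f) u \<le> emeasure lebesgue {x :: real ^ 'n. cube_volume x \<le> m}"
      unfolding dist_fun_def by (intro emeasure_mono) auto
    then show ?thesis unfolding emeasure_cube_volume_le[OF real(1)] real(2) .
  qed simp
  show "dist_fun f u \<le> dist_fun (radial_rearrangement f) u"
  proof (rule dense_le)
    fix y assume y: "y < dist_fun f u"
    then obtain s where s: "y = ennreal s" "0 \<le> s" by (cases y) auto
    have null: "{0 :: real ^ 'n} \<in> null_sets lebesgue" by simp
    \<comment> \<open>The origin is removed because finiteness of f* is assumed only at positive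
      arguments.\<close>
    have sub: "{x. cube_volume x \<le> s} - {0} \<subseteq> {x. u < \<bar>radial_rearrangement f x\<bar>}"
    proof
      fix x :: "real ^ 'n" assume x: "x \<in> {x. cube_volume x \<le> s} - {0}"
      then have "ennreal (cube_volume x) < dist_fun f u"
        using y s by (auto simp del: ennreal_le_iff intro: le_less_trans[OF ennreal_leI])
      then have "ennreal u < rearrangement f (cube_volume x)"
        using u by (intro less_rearrangement_of_less_dist_fun f) auto
      moreover have "rearrangement f (cube_volume x) < top" using x by (intro fin) simp
      ultimately show "x \<in> {x. u < \<bar>radial_rearrangement f x\<bar>}"
        using u by (cases "rearrangement f (cube_volume x)")
          (auto simp: radial_rearrangement_def ennreal_less_iff)
    qed
    have "y = emeasure lebesgue ({x :: real ^ 'n. cube_volume x \<le> s} - {0})"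
      unfolding emeasure_Diff_null_set[OF null cube_volume_le_measurable] emeasure_cube_volume_le[OF s(2)]
      by (rule s(1))
    also have "\<dots> \<le> dist_fun (radial_rearrangement f) u"
      unfolding dist_fun_def by (intro emeasure_mono sub) simp
    finally show "y \<le> dist_fun (radial_rearrangement f) u" .
  qed
qed

text \<open>Were mu_f finite at one level, continuity from above would make it tend to 0 along
  increasing levels, as \<open>f\<close> is real-valued, and then f*(t) would be finite.\<close>

lemma dist_fun_eq_top_of_rearrangement:
  assumes f: "f \<in> borel_measurable lebesgue" and t: "0 < t" "rearrangement f t = top"
  shows "dist_fun f u = top"
proof (rule ccontr)
  assume fin: "dist_fun f u \<noteq> top"
  \<comment> \<open>Levels tending to infinity that are positive, as the rearrangement requires, and
    at least \<open>u\<close>, where the measure is finite.\<close>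
  define v where "v k = max u 0 + 1 + real k" for k
  have v: "0 < v k" "u \<le> v k" for k by (auto simp: v_def)
  have "(INF k. dist_fun f (v k)) = emeasure lebesgue (\<Inter>k. {x. v k < \<bar>f x\<bar>})"
    unfolding dist_fun_def
  proof (rule INF_emeasure_decseq)
    show "decseq (\<lambda>k. {x. v k < \<bar>f x\<bar>})" by (auto simp: decseq_def v_def)
    show "emeasure lebesgue {x. v k < \<bar>f x\<bar>} \<noteq> \<infinity>" for k
      using dist_fun_antimono[OF f v(2)[of k]] fin by (auto simp: dist_fun_def top_unique)
  qed (use f in auto)
  also have "(\<Inter>k. {x. v k < \<bar>f x\<bar>}) = {}"
  proof (intro equals0I)
    fix x assume x: "x \<in> (\<Inter>k. {x. v k < \<bar>f x\<bar>})"
    obtain k where "\<bar>f x\<bar> < real k" using reals_Archimedean2 by blast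
    then show False using x by (auto simp: v_def dest: spec[of _ k])
  qed
  finally have "(INF k. dist_fun f (v k)) < ennreal t" using t by simp
  then obtain k where "dist_fun f (v k) < ennreal t" by (auto simp: INF_less_iff)
  then have "rearrangement f t \<le> ennreal (v k)" by (rule rearrangement_le_ennreal[OF v(1)])
  with t(2) show False by (simp add: top_unique)
qed

text \<open>Testing on the centred cube of volume \<open>t\<close> bounds the maximal function below
  at every point of that cube. The cube has positive measure, so the essential supremum inherits the
  bound. The origin is exempt since \<open>radial_rearrangement\<close> is not controlled
  there.\<close>

lemma esssup_frac_maximal_ge:
  fixes g :: "real ^ 'n \<Rightarrow> real"
  assumes t: "0 < t" and g: "\<And>x. x \<noteq> 0 \<Longrightarrow> cube_volume x \<le> t \<Longrightarrow> c \<le> ennreal \<bar>g x\<bar>"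
  shows "ennreal (t powr (\<alpha> / CARD('n))) * c \<le> esssup lebesgue (frac_maximal \<alpha> g)"
proof (rule ccontr)
  let ?Q = "{x :: real ^ 'n. cube_volume x \<le> t}"
  have emQ: "emeasure lebesgue ?Q = ennreal t" using t by (intro emeasure_cube_volume_le) simp
  then have mQ: "measure lebesgue ?Q = t" using t by (simp add: measure_def)
  have lower: "ennreal (t powr (\<alpha> / CARD('n))) * c \<le> frac_maximal \<alpha> g x" if "x \<in> ?Q" for x
  proof -
    have "ennreal (t powr (\<alpha> / CARD('n))) * c = ennreal (t powr (\<alpha> / CARD('n)) * (1 / t)) * (c * ennreal t)"
    proof -
      have "ennreal (t powr (\<alpha> / CARD('n)) * (1 / t)) * ennreal t = ennreal (t powr (\<alpha> / CARD('n)))"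
        using t by (simp add: ennreal_mult[symmetric])
      then show ?thesis by (metis mult.assoc mult.commute)
    qed
    also have "c * ennreal t = (\<integral>\<^sup>+y\<in>?Q. c \<partial>lebesgue)"
      by (subst nn_integral_cmult_indicator) (simp_all add: emQ del: emeasure_completion)
    also have "\<dots> \<le> (\<integral>\<^sup>+y\<in>?Q. ennreal \<bar>g y\<bar> \<partial>lebesgue)"
    proof (rule nn_integral_mono_AE)
      have "AE y in lebesgue. y \<noteq> (0 :: real ^ 'n)"
        by (intro AE_not_in[of "{0}", simplified]) simp
      then show "AE y in lebesgue. c * indicator ?Q y \<le> ennreal \<bar>g y\<bar> * indicator ?Q y"
        by eventually_elim (use g in \<open>auto split: split_indicator\<close>)
    qed
    finally show ?thesis
      using frac_maximal_upper[OF cube_volume_le_in_cubes[OF t] that, of \<alpha> g]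
      by (simp add: mQ mult_left_mono order_trans)
  qed
  assume "\<not> ennreal (t powr (\<alpha> / CARD('n))) * c \<le> esssup lebesgue (frac_maximal \<alpha> g)"
  then have "AE x in lebesgue. x \<notin> ?Q"
    using esssup_AE[of "frac_maximal \<alpha> g" lebesgue]
    by (elim eventually_mono) (metis lower order_trans)
  then have "emeasure lebesgue ?Q = 0"
    by (simp only: AE_iff_null_sets[symmetric] null_sets_def cube_volume_le_measurable) simp
  then show False using emQ t by simp
qed

lemma (in ri_norm) ri_space_subset_weak_Lp:
  assumes sub: "ri_space \<rho> \<subseteq> X_space \<alpha>" and \<alpha>: "0 < \<alpha>"
  shows "ri_space \<rho> \<subseteq> weak_Lp (real CARD('n) / \<alpha>)"
proof
  fix f assume fri: "f \<in> ri_space \<rho>"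
  then have f: "f \<in> borel_measurable lebesgue" by (simp add: ri_space_def)
  \<comment> \<open>Rearrangement invariance enters here: every function equimeasurable with
    \<open>f\<close> lies in the space, hence in \<open>X_space\<close>.\<close>
  have equi: "esssup lebesgue (frac_maximal \<alpha> g) < \<infinity>"
    if g: "g \<in> borel_measurable lebesgue" and eq: "\<And>u. 0 < u \<Longrightarrow> dist_fun g u = dist_fun f u" for g :: "real ^ 'n \<Rightarrow> real"
  proof -
    have "\<rho> g = \<rho> f"
      by (rule rearrangement_invariant[OF g f]) (use eq in \<open>auto intro: rearrangement_cong\<close>)
    then have "g \<in> ri_space \<rho>" using fri g by (simp add: ri_space_def)
    then show ?thesis using sub by (auto simp: X_space_def)
  qed
  have fin: "rearrangement f t < top" if t: "0 < t" for t
  proof (rule ccontr)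
    assume "\<not> rearrangement f t < top"
    then have top: "dist_fun f u = top" for u
      using dist_fun_eq_top_of_rearrangement[OF f t] by (simp add: less_top[symmetric])
    let ?g = "\<lambda>x :: real ^ 'n. 1 + cube_volume x"
    have "esssup lebesgue (frac_maximal \<alpha> ?g) < \<infinity>"
    proof (rule equi)
      fix u :: real assume u: "0 < u"
      \<comment> \<open>Outside the centred cube of volume \<open>u\<close> the function exceeds
        \<open>u\<close>, and this complement has infinite measure.\<close>
      have "top = emeasure lebesgue (space lebesgue - {x :: real ^ 'n. cube_volume x \<le> u})"
      proof (subst emeasure_compl)
        show "top = emeasure lebesgue (space lebesgue) - emeasure lebesgue {x :: real ^ 'n. cube_volume x \<le> u}"
          unfolding emeasure_cube_volume_le[OF less_imp_le[OF u]] by (simp add: emeasure_lborel_UNIV)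
      qed (use u in \<open>simp_all add: emeasure_cube_volume_le del: emeasure_completion\<close>)
      also have "\<dots> \<le> dist_fun ?g u"
        unfolding dist_fun_def by (intro emeasure_mono superlevel_measurable) (auto, measurable)
      finally show "dist_fun ?g u = dist_fun f u" using top by (simp add: top_unique)
    qed measurable
    then obtain e where e: "esssup lebesgue (frac_maximal \<alpha> ?g) = ennreal e" "0 \<le> e"
      by (cases "esssup lebesgue (frac_maximal \<alpha> ?g)") auto
    \<comment> \<open>The volume for which the factor \<open>s powr (\<alpha> / CARD('n))\<close>
      becomes e + 1; since the test function is at least 1, this exceeds the supposed bound
      \<open>e\<close>.\<close>
    define s where "s = (e + 1) powr (real CARD('n) / \<alpha>)"
    have "0 < s" using e(2) by (simp add: s_def)
    have "s powr (\<alpha> / CARD('n)) = e + 1" using e(2) \<alpha> by (simp add: s_def powr_powr)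
    moreover have "ennreal (s powr (\<alpha> / CARD('n))) * 1 \<le> esssup lebesgue (frac_maximal \<alpha> ?g)"
      by (rule esssup_frac_maximal_ge[OF \<open>0 < s\<close>]) (simp add: ennreal_ge_1)
    ultimately show False using e by simp
  qed
  have "(SUP t\<in>{0<..}. ennreal (t powr (1 / (real CARD('n) / \<alpha>))) * rearrangement f t)
      \<le> esssup lebesgue (frac_maximal \<alpha> (radial_rearrangement f))"
  proof (rule SUP_least)
    fix t :: real assume "t \<in> {0<..}"
    then have t: "0 < t" by simp
    have "ennreal (t powr (\<alpha> / CARD('n))) * rearrangement f t
        \<le> esssup lebesgue (frac_maximal \<alpha> (radial_rearrangement f))"
    proof (rule esssup_frac_maximal_ge[OF t])
      fix x :: "real ^ 'n" assume x: "x \<noteq> 0" "cube_volume x \<le> t"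
      have "rearrangement f t \<le> rearrangement f (cube_volume x)"
        by (rule rearrangement_antimono[OF x(2)])
      then show "rearrangement f t \<le> ennreal \<bar>radial_rearrangement f x\<bar>"
        using fin[of "cube_volume x"] x(1) by (simp add: radial_rearrangement_def)
    qed
    then show "ennreal (t powr (1 / (real CARD('n) / \<alpha>))) * rearrangement f t
        \<le> esssup lebesgue (frac_maximal \<alpha> (radial_rearrangement f))" by simp
  qed
  also have "\<dots> < \<infinity>"
    by (intro equi dist_fun_radial_rearrangement f fin) auto
  finally show "f \<in> weak_Lp (real CARD('n) / \<alpha>)" using f by (simp add: weak_Lp_def)
qed

theorem theorem3p1:
  fixes \<alpha> :: real
  assumes "0 < \<alpha>" and "\<alpha> < real CARD('n::finite)"
  shows "(X_tilde \<alpha> :: (real ^ 'n \<Rightarrow> real) set) = weak_Lp (real CARD('n) / \<alpha>) \<and>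
    ri_norm (weak_Lp_norm (real CARD('n) / \<alpha>) :: (real ^ 'n \<Rightarrow> real) \<Rightarrow> ennreal) \<and>
    ri_space (weak_Lp_norm (real CARD('n) / \<alpha>)) =
      (weak_Lp (real CARD('n) / \<alpha>) :: (real ^ 'n \<Rightarrow> real) set) \<and>
    frac_maximal_bounded \<alpha>
      (weak_Lp_norm (real CARD('n) / \<alpha>) :: (real ^ 'n \<Rightarrow> real) \<Rightarrow> ennreal) \<and>
    (\<forall>\<rho> :: (real ^ 'n \<Rightarrow> real) \<Rightarrow> ennreal.
       ri_norm \<rho> \<and> frac_maximal_bounded \<alpha> \<rho> \<longrightarrow>
       ri_space \<rho> \<subseteq> weak_Lp (real CARD('n) / \<alpha>))"
proof (intro conjI allI impI)
  let ?N = "weak_Lp_norm (real CARD('n) / \<alpha>) :: (real ^ 'n \<Rightarrow> real) \<Rightarrow> ennreal"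
  \<comment> \<open>The condition \<alpha> < n enters as p > 1, which makes f** and f* give the same
    space.\<close>
  have p: "1 < real CARD('n) / \<alpha>" using assms by simp
  show N: "ri_norm ?N" by (rule ri_norm_weak_Lp_norm[OF p])
  show eq: "ri_space ?N = weak_Lp (real CARD('n) / \<alpha>)" by (rule ri_space_weak_Lp_norm[OF p])
  show bdd: "frac_maximal_bounded \<alpha> ?N" by (rule frac_maximal_bounded_weak_Lp_norm)
  show "ri_space \<rho> \<subseteq> weak_Lp (real CARD('n) / \<alpha>)"
    if "ri_norm \<rho> \<and> frac_maximal_bounded \<alpha> \<rho>" for \<rho> :: "(real ^ 'n \<Rightarrow> real) \<Rightarrow> ennreal"
    using that assms(1) ri_norm.ri_space_subset_weak_Lp ri_norm.ri_space_subset_X_space by blast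
  show "X_tilde \<alpha> = (weak_Lp (real CARD('n) / \<alpha>) :: (real ^ 'n \<Rightarrow> real) set)"
  proof
    show "X_tilde \<alpha> \<subseteq> (weak_Lp (real CARD('n) / \<alpha>) :: (real ^ 'n \<Rightarrow> real) set)"
      unfolding X_tilde_def using ri_norm.ri_space_subset_weak_Lp assms(1) by blast
    \<comment> \<open>Weak \<open>L^p\<close> is itself one of the spaces in the union, so the
      reverse inclusion needs no further construction.\<close>
    have "ri_space ?N \<subseteq> X_space \<alpha>" by (rule ri_norm.ri_space_subset_X_space[OF N bdd])
    then show "weak_Lp (real CARD('n) / \<alpha>) \<subseteq> (X_tilde \<alpha> :: (real ^ 'n \<Rightarrow> real) set)"
      unfolding X_tilde_def using N eq by blast
  qed
qed

end
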